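(* Let $\langle G\rightarrow S,\alpha\rightarrow A\rangle$ be an ordinary voltage graph embedding. Let $I\in C_2(S)$ be such that $S[I]$ is connected, let $y\in C_1(S[I])$ be such that $G[y]$ is connected, and let $W$ be a closed walk in $G[y]$ based at $v\in V(G[y])$. Then: (1) There are $\frac{|A|}{|A(v)|}$ components of $S^\alpha$. (2) There are $\frac{|A(v)|}{|A(v,S[I])|}$ components of $S[I]^\alpha$ contained in each component of $S^\alpha$. (3) There are $\frac{|A(v,S[I])|}{|A(v,G[y])|}$ components of $G[y]^\alpha$ contained in each component of $S[I]^\alpha$. (4) There are $\frac{|A(v,G[y])|}{|\langle\omega(W)\rangle|}$ sets of consecutive lifts of $W$ in each component of $G[y]^\alpha$.
   Context: Graphs are finite connected multigraphs (loops and multiple edges allowed). $S$ is a compact connected surface without boundary, and $G\rightarrow S$ denotes a cellular embedding of $G$ in $S$ (it subdivides $S$ into 2-cells). $D(G)$ is the set of darts (directed edges); a dart $d$ has tail $t(d)$, head $h(d)$ and opposite dart $d^{-1}$; each edge has one dart chosen as positive, also denoted $e$. A walk is a sequence of darts $d_1\cdots d_m$ with $h(d_i)=t(d_{i+1})$; it is closed if $h(d_m)=t(d_1)$, and it is based at $t(d_1)$. An ordinary voltage graph embedding $\langle G\rightarrow S,\alpha\rightarrow A\rangle$ consists of a cellular embedding $G\rightarrow S$, a finite group $A$, and a map $\alpha:D(G)\to A$ with $\alpha(d^{-1})=\alpha(d)^{-1}$. The net voltage of $W=d_1\cdots d_m$ is $\omega(W)=\alpha(d_1)\cdots\alpha(d_m)$.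 The derived graph $G^\alpha$ has vertices $v^a=(v,a)$ and edges $e^a=(e,a)$ ($v\in V(G)$, $e\in E(G)$, $a\in A$), the directed edge $e^a$ going from $t(e)^a$ to $h(e)^{a\alpha(e)}$; $p$ is the projection $v^a\mapsto v$, $e^a\mapsto e$. The derived embedding $G^\alpha\rightarrow S^\alpha$ is obtained by gluing a 2-cell to each closed walk of $G^\alpha$ that is a lift of a facial boundary: if a face has boundary walk $W_f$ with $\omega(W_f)$ of order $r$, there are $|A|/r$ faces over it, each bounded by a concatenation of $r$ successive lifts of $W_f$. $S^\alpha$ need not be connected; $p$ extends to a (possibly branched) covering $p:S^\alpha\to S$. $C_i(S)$ are the $\mathbb{Z}_2$-chains of the 2-complex induced by $G\rightarrow S$ (formal sums of vertices, edges, faces for $i=0,1,2$). For $I\in C_2(S)$, $S[I]$ is the subcomplex consisting of the faces of $I$ and all their subfaces, and $G[I]$ is the subgraph of $G$ consisting of the vertices and edges of $S[I]$. $C_1(S[I])$ is the set of 1-chains of $S[I]$. For a 1-chain $y$, $G[y]$ is the subgraph induced by the edges of $y$. For a subcomplex or subgraph $X$, $X^\alpha$ denotes the part of the derived embedding lying over $X$ (its preimage under $p$). $A(v)$ is the group of net voltages of closed walks in $G$ based at $v$; $A(v,S[I])$ is the group of net voltages of closed walks in $G[I]$ based at $v$; $A(v,G[y])$ is the group of net voltages of closed walks in $G[y]$ based at $v$. For a closed walk $W$ based at $v$, $W_v^a$ is the lift of $W$ beginning at $v^a$ (it ends at $v^{a\omega(W)}$). The set of consecutive lifts of $W$ containing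 $W_v^a$ is $\hat W_v^a=\{W_v^{a},W_v^{a\omega(W)},W_v^{a\omega(W)^2},\ldots,W_v^{a\omega(W)^{|\langle\omega(W)\rangle|-1}}\}$. *)

theory Defs
  imports
    "HOL-Analysis.Analysis"
    "HOL-Algebra.Generated_Groups"
    "HOL-Library.Poly_Mapping"
    "HOL-Library.Z2"
    "Graph_Theory.Digraph_Component"
begin

section \<open>Multigraphs, darts and walks\<close>

text \<open>
  A multigraph is a \<^typ>\<open>('v, 'e) pre_digraph\<close>: every arc is an edge together with its positive
  direction. The dart \<open>(e, True)\<close> is the positive dart of \<open>e\<close>, \<open>(e, False)\<close> its opposite.
  Walks of the multigraph are the \<open>awalk\<close>s of its digraph of darts; the empty list of darts is
  the trivial walk at its base vertex.
\<close>

definition dart_graph :: "('v, 'e) pre_digraph \<Rightarrow> ('v, 'e \<times> bool) pre_digraph" where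
  "dart_graph G =
     \<lparr>verts = verts G, arcs = arcs G \<times> UNIV,
      tail = (\<lambda>(e, s). if s then tail G e else head G e),
      head = (\<lambda>(e, s). if s then head G e else tail G e)\<rparr>"

definition opposite :: "'e \<times> bool \<Rightarrow> 'e \<times> bool" where
  "opposite d = (fst d, \<not> snd d)"

definition closed_walk :: "('v, 'e) pre_digraph \<Rightarrow> 'v \<Rightarrow> ('e \<times> bool) list \<Rightarrow> bool" where
  "closed_walk G v p \<longleftrightarrow> pre_digraph.awalk (dart_graph G) v p v"

text \<open>
  \<^const>\<open>Digraph_Component.connected\<close> ignores the directions of the arcs and excludes the empty
  graph.
\<close>

definition finite_connected_multigraph :: "('v, 'e) pre_digraph \<Rightarrow> bool" where
  "finite_connected_multigraph G \<longleftrightarrow> fin_digraph G \<and> Digraph_Component.connected G"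


section \<open>The space glued from a graph and facial boundary walks\<close>

text \<open>
  Faces are indexed by a set \<open>F\<close>; \<open>B f = (u, p)\<close> is the boundary walk \<open>p\<close> of the face \<open>f\<close>, a
  closed walk based at \<open>u\<close>. The points of the glued space are the vertices, the points of the
  open edges (parametrized by \<open>0 < t < 1\<close> in the positive direction) and the points of the open
  faces (parametrized by the open unit disc).
\<close>

datatype ('v, 'e, 'f) point = Vertex 'v | EdgePt 'e real | FacePt 'f complex

type_synonym ('v, 'e, 'f) boundary = "'f \<Rightarrow> 'v \<times> ('e \<times> bool) list"

definition cell_points :: "('v, 'e) pre_digraph \<Rightarrow> 'f set \<Rightarrow> ('v, 'e, 'f) point set" where
  "cell_points G F =
     Vertex ` verts G \<union> {EdgePt e t |e t. e \<in> arcs G \<and> 0 < t \<and> t < 1} \<union>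
     {FacePt f z |f z. f \<in> F \<and> norm z < 1}"

definition edge_map :: "('v, 'e) pre_digraph \<Rightarrow> 'e \<Rightarrow> real \<Rightarrow> ('v, 'e, 'f) point" where
  "edge_map G e t =
     (if t = 0 then Vertex (tail G e) else if t = 1 then Vertex (head G e) else EdgePt e t)"

definition dart_map :: "('v, 'e) pre_digraph \<Rightarrow> 'e \<times> bool \<Rightarrow> real \<Rightarrow> ('v, 'e, 'f) point" where
  "dart_map G d t = edge_map G (fst d) (if snd d then t else 1 - t)"

text \<open>
  The walk \<open>p\<close> from \<open>u\<close> traversed at constant speed, for parameters \<open>0 \<le> s < 1\<close>; a trivial walk
  stays at \<open>u\<close>.
\<close>

definition walk_map :: "('v, 'e) pre_digraph \<Rightarrow> 'v \<times> ('e \<times> bool) list \<Rightarrow> real \<Rightarrow> ('v, 'e, 'f) point" where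
  "walk_map G w s =
     (case w of (u, p) \<Rightarrow>
        if p = [] then Vertex u
        else dart_map G (p ! nat \<lfloor>s * real (length p)\<rfloor>) (frac (s * real (length p))))"

definition face_map ::
  "('v, 'e) pre_digraph \<Rightarrow> ('v, 'e, 'f) boundary \<Rightarrow> 'f \<Rightarrow> complex \<Rightarrow> ('v, 'e, 'f) point" where
  "face_map G B f z = (if norm z < 1 then FacePt f z else walk_map G (B f) (Arg2pi z / (2 * pi)))"

text \<open>
  The topology is the quotient topology: a set is open iff its preimages in all closed edges and
  all closed faces are open.
\<close>

definition realization ::
  "('v, 'e) pre_digraph \<Rightarrow> 'f set \<Rightarrow> ('v, 'e, 'f) boundary \<Rightarrow> ('v, 'e, 'f) point topology" where
  "realization G F B = topology (\<lambda>U. U \<subseteq> cell_points G F \<and>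
     (\<forall>e\<in>arcs G. openin (top_of_set {0..1}) {t \<in> {0..1}. edge_map G e t \<in> U}) \<and>
     (\<forall>f\<in>F. openin (top_of_set (cball 0 1)) {z \<in> cball 0 1. face_map G B f z \<in> U}))"

lemma openin_realization:
  "openin (realization G F B) U \<longleftrightarrow> U \<subseteq> cell_points G F \<and>
     (\<forall>e\<in>arcs G. openin (top_of_set {0..1}) {t \<in> {0..1}. edge_map G e t \<in> U}) \<and>
     (\<forall>f\<in>F. openin (top_of_set (cball 0 1)) {z \<in> cball 0 1. face_map G B f z \<in> U})"
proof -
  have inter: "openin T {x \<in> D. g x \<in> U \<inter> V}"
    if "openin T {x \<in> D. g x \<in> U}" "openin T {x \<in> D. g x \<in> V}"
    for T :: "'x topology" and D and g :: "'x \<Rightarrow> ('v, 'e, 'f) point" and U V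
  proof -
    have "{x \<in> D. g x \<in> U \<inter> V} = {x \<in> D. g x \<in> U} \<inter> {x \<in> D. g x \<in> V}" by auto
    then show ?thesis using openin_Int[OF that] by simp
  qed
  have union: "openin T {x \<in> D. g x \<in> \<Union>K}"
    if "\<forall>U\<in>K. openin T {x \<in> D. g x \<in> U}"
    for T :: "'x topology" and D and g :: "'x \<Rightarrow> ('v, 'e, 'f) point" and K
  proof -
    have "{x \<in> D. g x \<in> \<Union>K} = (\<Union>U\<in>K. {x \<in> D. g x \<in> U})" by auto
    then show ?thesis using that by (simp add: openin_clauses(3))
  qed
  define P where "P = (\<lambda>U. U \<subseteq> cell_points G F \<and>
     (\<forall>e\<in>arcs G. openin (top_of_set {0..1}) {t \<in> {0..1}. edge_map G e t \<in> U}) \<and>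
     (\<forall>f\<in>F. openin (top_of_set (cball 0 1)) {z \<in> cball 0 1. face_map G B f z \<in> U}))"
  have "P (U \<inter> V)" if "P U" "P V" for U V
    unfolding P_def
  proof (intro conjI ballI)
    show "U \<inter> V \<subseteq> cell_points G F" using that(1) by (auto simp: P_def)
  qed (rule inter; use that in \<open>simp add: P_def\<close>)+
  moreover have "P (\<Union>K)" if "\<forall>U\<in>K. P U" for K
    unfolding P_def
  proof (intro conjI ballI)
    show "\<Union>K \<subseteq> cell_points G F" using that by (auto simp: P_def)
  qed (rule union; use that in \<open>simp add: P_def\<close>)+
  ultimately have "istopology P"
    unfolding istopology_def by blast
  then have "openin (topology P) U \<longleftrightarrow> P U" by (simp add: topology_inverse')
  then show ?thesis
    by (simp only: realization_def P_def)
qed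


section \<open>Cellular embeddings\<close>

definition closed_surface :: "'s topology \<Rightarrow> bool" where
  "closed_surface S \<longleftrightarrow>
     topspace S \<noteq> {} \<and> compact_space S \<and> connected_space S \<and> Hausdorff_space S \<and>
     (\<forall>x\<in>topspace S. \<exists>U. openin S U \<and> x \<in> U \<and>
        subtopology S U homeomorphic_space (euclidean :: complex topology))"

text \<open>
  The homeomorphism \<open>h\<close> places the vertices, edges and faces in \<open>S\<close>.
\<close>

definition cellular_embedding ::
  "('v, 'e) pre_digraph \<Rightarrow> 'f set \<Rightarrow> ('v, 'e, 'f) boundary \<Rightarrow> 's topology \<Rightarrow>
   (('v, 'e, 'f) point \<Rightarrow> 's) \<Rightarrow> bool" where
  "cellular_embedding G F B S h \<longleftrightarrow>
     finite_connected_multigraph G \<and> finite F \<and>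
     (\<forall>f\<in>F. closed_walk G (fst (B f)) (snd (B f))) \<and>
     closed_surface S \<and> homeomorphic_map (realization G F B) S h"

definition mod2_chains :: "'c set \<Rightarrow> ('c \<Rightarrow>\<^sub>0 bit) set" where
  "mod2_chains X = {c. Poly_Mapping.keys c \<subseteq> X}"

text \<open>\<open>S[I]\<close> consists of the subgraph \<open>G[I]\<close> and the faces of \<open>I\<close>.\<close>

definition face_subgraph ::
  "('v, 'e) pre_digraph \<Rightarrow> ('v, 'e, 'f) boundary \<Rightarrow> ('f \<Rightarrow>\<^sub>0 bit) \<Rightarrow> ('v, 'e) pre_digraph" where
  "face_subgraph G B I =
     G\<lparr>verts := \<Union>f\<in>Poly_Mapping.keys I.
                  set (pre_digraph.awalk_verts (dart_graph G) (fst (B f)) (snd (B f))),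
       arcs := \<Union>f\<in>Poly_Mapping.keys I. fst ` set (snd (B f))\<rparr>"

definition edge_subgraph ::
  "('v, 'e) pre_digraph \<Rightarrow> ('e \<Rightarrow>\<^sub>0 bit) \<Rightarrow> ('v, 'e) pre_digraph" where
  "edge_subgraph G y =
     G\<lparr>verts := tail G ` Poly_Mapping.keys y \<union> head G ` Poly_Mapping.keys y,
       arcs := Poly_Mapping.keys y\<rparr>"

definition face_subcomplex ::
  "('v, 'e) pre_digraph \<Rightarrow> ('v, 'e, 'f) boundary \<Rightarrow> (('v, 'e, 'f) point \<Rightarrow> 's) \<Rightarrow>
   ('f \<Rightarrow>\<^sub>0 bit) \<Rightarrow> 's set" where
  "face_subcomplex G B h I = h ` cell_points (face_subgraph G B I) (Poly_Mapping.keys I)"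

definition edge_subcomplex ::
  "('v, 'e) pre_digraph \<Rightarrow> (('v, 'e, 'f) point \<Rightarrow> 's) \<Rightarrow> ('e \<Rightarrow>\<^sub>0 bit) \<Rightarrow> 's set" where
  "edge_subcomplex G h y = h ` cell_points (edge_subgraph G y) {}"


section \<open>Voltages and derived embeddings\<close>

definition voltage_assignment ::
  "('v, 'e) pre_digraph \<Rightarrow> ('a, 'm) monoid_scheme \<Rightarrow> ('e \<times> bool \<Rightarrow> 'a) \<Rightarrow> bool" where
  "voltage_assignment G A \<alpha> \<longleftrightarrow>
     (\<forall>d\<in>arcs (dart_graph G). \<alpha> d \<in> carrier A \<and> \<alpha> (opposite d) = inv\<^bsub>A\<^esub> (\<alpha> d))"

definition voltage_graph_embedding ::
  "('v, 'e) pre_digraph \<Rightarrow> 'f set \<Rightarrow> ('v, 'e, 'f) boundary \<Rightarrow> 's topology \<Rightarrow>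
   (('v, 'e, 'f) point \<Rightarrow> 's) \<Rightarrow> ('a, 'm) monoid_scheme \<Rightarrow> ('e \<times> bool \<Rightarrow> 'a) \<Rightarrow> bool" where
  "voltage_graph_embedding G F B S h A \<alpha> \<longleftrightarrow>
     cellular_embedding G F B S h \<and> group A \<and> finite (carrier A) \<and> voltage_assignment G A \<alpha>"

definition net_voltage ::
  "('a, 'm) monoid_scheme \<Rightarrow> ('e \<times> bool \<Rightarrow> 'a) \<Rightarrow> ('e \<times> bool) list \<Rightarrow> 'a" where
  "net_voltage A \<alpha> p = foldr (\<lambda>d x. \<alpha> d \<otimes>\<^bsub>A\<^esub> x) p \<one>\<^bsub>A\<^esub>"

definition local_voltage_group ::
  "('a, 'm) monoid_scheme \<Rightarrow> ('e \<times> bool \<Rightarrow> 'a) \<Rightarrow> ('v, 'e) pre_digraph \<Rightarrow> 'v \<Rightarrow> 'a set" where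
  "local_voltage_group A \<alpha> H v = {net_voltage A \<alpha> p |p. closed_walk H v p}"

definition derived_graph ::
  "('v, 'e) pre_digraph \<Rightarrow> ('a, 'm) monoid_scheme \<Rightarrow> ('e \<times> bool \<Rightarrow> 'a) \<Rightarrow>
   ('v \<times> 'a, 'e \<times> 'a) pre_digraph" where
  "derived_graph G A \<alpha> =
     \<lparr>verts = verts G \<times> carrier A, arcs = arcs G \<times> carrier A,
      tail = (\<lambda>(e, a). (tail G e, a)),
      head = (\<lambda>(e, a). (head G e, a \<otimes>\<^bsub>A\<^esub> \<alpha> (e, True)))\<rparr>"

text \<open>
  The lift of a negative dart of \<open>e\<close> that leaves the fibre element \<open>a\<close> runs backwards along the
  edge over \<open>e\<close> ending there, which is the one with index \<open>a \<otimes> \<alpha> (e, False)\<close>.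
\<close>

fun lift :: "('a, 'm) monoid_scheme \<Rightarrow> ('e \<times> bool \<Rightarrow> 'a) \<Rightarrow> 'a \<Rightarrow> ('e \<times> bool) list \<Rightarrow>
  (('e \<times> 'a) \<times> bool) list" where
  "lift A \<alpha> a [] = []"
| "lift A \<alpha> a ((e, s) # p) =
     ((e, if s then a else a \<otimes>\<^bsub>A\<^esub> \<alpha> (e, False)), s) # lift A \<alpha> (a \<otimes>\<^bsub>A\<^esub> \<alpha> (e, s)) p"

text \<open>
  Let the face \<open>f\<close> have boundary walk \<open>p\<close> based at \<open>u\<close> and \<open>r = ord (\<omega> p)\<close>. The lifts of \<open>p\<close>
  starting at the vertices \<open>(u, b)\<close>, where \<open>b\<close> runs through a left coset \<open>c\<close> of \<open>\<langle>\<omega> p\<rangle>\<close>, are the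
  \<open>r\<close> successive lifts bounding one face over \<open>f\<close>; that face is \<open>(f, c)\<close>, and \<open>card c = r\<close>. The
  choice of the initial element of \<open>c\<close> only rotates the boundary walk.
\<close>

definition derived_faces ::
  "'f set \<Rightarrow> ('v, 'e, 'f) boundary \<Rightarrow> ('a, 'm) monoid_scheme \<Rightarrow> ('e \<times> bool \<Rightarrow> 'a) \<Rightarrow>
   ('f \<times> 'a set) set" where
  "derived_faces F B A \<alpha> =
     {(f, a <#\<^bsub>A\<^esub> generate A {net_voltage A \<alpha> (snd (B f))}) |f a. f \<in> F \<and> a \<in> carrier A}"

definition derived_boundary ::
  "('v, 'e, 'f) boundary \<Rightarrow> ('a, 'm) monoid_scheme \<Rightarrow> ('e \<times> bool \<Rightarrow> 'a) \<Rightarrow>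
   ('v \<times> 'a, 'e \<times> 'a, 'f \<times> 'a set) boundary" where
  "derived_boundary B A \<alpha> =
     (\<lambda>(f, c). let a = (SOME a. a \<in> c) in
        ((fst (B f), a), lift A \<alpha> a (concat (replicate (card c) (snd (B f))))))"

definition derived_surface ::
  "('v, 'e) pre_digraph \<Rightarrow> 'f set \<Rightarrow> ('v, 'e, 'f) boundary \<Rightarrow> ('a, 'm) monoid_scheme \<Rightarrow>
   ('e \<times> bool \<Rightarrow> 'a) \<Rightarrow> ('v \<times> 'a, 'e \<times> 'a, 'f \<times> 'a set) point topology" where
  "derived_surface G F B A \<alpha> =
     realization (derived_graph G A \<alpha>) (derived_faces F B A \<alpha>) (derived_boundary B A \<alpha>)"

text \<open>
  A face over \<open>f\<close> bounded by \<open>r\<close> successive lifts is wrapped \<open>r\<close> times around \<open>f\<close>, hence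
  \<open>z \<mapsto> z ^ r\<close>; on the bounding circles this agrees with the projection of the boundary walks.
\<close>

fun cell_projection :: "('v \<times> 'a, 'e \<times> 'a, 'f \<times> 'a set) point \<Rightarrow> ('v, 'e, 'f) point" where
  "cell_projection (Vertex (v, a)) = Vertex v"
| "cell_projection (EdgePt (e, a) t) = EdgePt e t"
| "cell_projection (FacePt (f, c) z) = FacePt f (z ^ card c)"

text \<open>The part of the derived embedding over a set \<open>X\<close> of points of \<open>S\<close>, and its components.\<close>

definition lying_over ::
  "('v, 'e) pre_digraph \<Rightarrow> 'f set \<Rightarrow> ('v, 'e, 'f) boundary \<Rightarrow> (('v, 'e, 'f) point \<Rightarrow> 's) \<Rightarrow>
   ('a, 'm) monoid_scheme \<Rightarrow> ('e \<times> bool \<Rightarrow> 'a) \<Rightarrow> 's set \<Rightarrow>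
   ('v \<times> 'a, 'e \<times> 'a, 'f \<times> 'a set) point set" where
  "lying_over G F B h A \<alpha> X =
     {x \<in> topspace (derived_surface G F B A \<alpha>). h (cell_projection x) \<in> X}"

definition components_over ::
  "('v, 'e) pre_digraph \<Rightarrow> 'f set \<Rightarrow> ('v, 'e, 'f) boundary \<Rightarrow> (('v, 'e, 'f) point \<Rightarrow> 's) \<Rightarrow>
   ('a, 'm) monoid_scheme \<Rightarrow> ('e \<times> bool \<Rightarrow> 'a) \<Rightarrow> 's set \<Rightarrow>
   ('v \<times> 'a, 'e \<times> 'a, 'f \<times> 'a set) point set set" where
  "components_over G F B h A \<alpha> X =
     connected_components_of
       (subtopology (derived_surface G F B A \<alpha>) (lying_over G F B h A \<alpha> X))"

definition consecutive_lifts ::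
  "('a, 'm) monoid_scheme \<Rightarrow> ('e \<times> bool \<Rightarrow> 'a) \<Rightarrow> 'v \<Rightarrow> ('e \<times> bool) list \<Rightarrow> 'a \<Rightarrow>
   (('v \<times> 'a) \<times> (('e \<times> 'a) \<times> bool) list) set" where
  "consecutive_lifts A \<alpha> v p a =
     (\<lambda>i. let b = a \<otimes>\<^bsub>A\<^esub> (net_voltage A \<alpha> p [^]\<^bsub>A\<^esub> (i :: nat)) in ((v, b), lift A \<alpha> b p)) `
       {..<card (generate A {net_voltage A \<alpha> p})}"

definition walk_points ::
  "('v, 'e) pre_digraph \<Rightarrow> 'v \<times> ('e \<times> bool) list \<Rightarrow> ('v, 'e, 'f) point set" where
  "walk_points G w = insert (Vertex (fst w)) (\<Union>d\<in>set (snd w). dart_map G d ` {0..1})"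

text \<open>The sets of consecutive lifts of the closed walk \<open>p\<close> based at \<open>v\<close> that run in the set \<open>C\<close>.\<close>

definition consecutive_lift_sets_in ::
  "('v, 'e) pre_digraph \<Rightarrow> ('a, 'm) monoid_scheme \<Rightarrow> ('e \<times> bool \<Rightarrow> 'a) \<Rightarrow> 'v \<Rightarrow>
   ('e \<times> bool) list \<Rightarrow> ('v \<times> 'a, 'e \<times> 'a, 'f) point set \<Rightarrow>
   (('v \<times> 'a) \<times> (('e \<times> 'a) \<times> bool) list) set set" where
  "consecutive_lift_sets_in G A \<alpha> v p C =
     {L \<in> consecutive_lifts A \<alpha> v p ` carrier A.
        \<forall>w\<in>L. walk_points (derived_graph G A \<alpha>) w \<subseteq> C}"

end

theory Submission
  imports Defs "HOL-Algebra.Multiplicative_Group" "HOL-Algebra.Left_Coset"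
begin

text \<open>
  Everything is counted on the fibre over the base vertex \<open>v\<close>. For a connected subcomplex \<open>X\<close>
  through \<open>v\<close>, the points \<open>(v, a)\<close> and \<open>(v, b)\<close> lie in the same component of \<open>X\<^sup>\<alpha>\<close> iff some closed walk
  of the graph of \<open>X\<close> at \<open>v\<close> lifts to a walk from one to the other, that is, iff \<open>a\<close> and \<open>b\<close> are in
  the same left coset of the local voltage group \<open>A(v, X)\<close> (\<open>fibre_point_in_component\<close>). As the graph
  of \<open>X\<close> is connected, every component of \<open>X\<^sup>\<alpha>\<close> meets this fibre (\<open>derived_components_eq\<close>), so the
  components are the left cosets of \<open>A(v, X)\<close>. The local groups shrink along \<open>S \<supseteq> S[I] \<supseteq> G[y]\<close>, and
  \<open>\<langle>\<omega>(W)\<rangle>\<close> is contained in the last one; the sets of consecutive lifts of \<open>W\<close> are the left cosets of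
  \<open>\<langle>\<omega>(W)\<rangle>\<close>. Each of the four counts is therefore the number of cosets of a smaller group in one coset
  of a larger one, an index (\<open>card_image_l_coset\<close>).

  The topological content is that the components of a subcomplex are the components of its graph
  (\<open>component_iff_reachable\<close>). Walks and closed cells are connected as continuous images of intervals
  and discs. In the other direction, a set of vertices closed under adjacency splits the subcomplex
  into two disjoint subcomplexes, and subcomplexes are closed in the quotient topology
  (\<open>closedin_subcomplex\<close>), so no connected set meets both. The same fact, used downstairs, turns the
  connectedness of \<open>S[I]\<close> into connectedness of the graph \<open>G[I]\<close>.
\<close>

section \<open>Darts and walks\<close>

lemma dart_graph_simps [simp]:
  "verts (dart_graph G) = verts G"
  "arcs (dart_graph G) = arcs G \<times> UNIV"
  "tail (dart_graph G) (e, s) = (if s then tail G e else head G e)"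
  "head (dart_graph G) (e, s) = (if s then head G e else tail G e)"
  by (simp_all add: dart_graph_def)

lemma opposite_ends [simp]:
  "tail (dart_graph G) (opposite d) = head (dart_graph G) d"
  "head (dart_graph G) (opposite d) = tail (dart_graph G) d"
  by (cases d; simp add: opposite_def)+

lemma wf_dart_graph:
  assumes "wf_digraph G"
  shows "wf_digraph (dart_graph G)"
proof
  interpret wf_digraph G by fact
  show "tail (dart_graph G) d \<in> verts (dart_graph G)" "head (dart_graph G) d \<in> verts (dart_graph G)"
    if "d \<in> arcs (dart_graph G)" for d
    using that by (cases d; simp split: if_splits)+
qed

lemma cas_dart_cong:
  assumes "tail H = tail G" "head H = head G"
  shows "pre_digraph.cas (dart_graph H) u p w \<longleftrightarrow> pre_digraph.cas (dart_graph G) u p w"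
proof -
  have "tail (dart_graph H) = tail (dart_graph G)" "head (dart_graph H) = head (dart_graph G)"
    unfolding dart_graph_def assms by simp_all
  then show ?thesis by (induction p arbitrary: u) (simp_all add: pre_digraph.cas.simps)
qed

lemma dart_map_0 [simp]: "dart_map G d 0 = Vertex (tail (dart_graph G) d)"
  and dart_map_1 [simp]: "dart_map G d 1 = Vertex (head (dart_graph G) d)"
  by (cases d; simp add: dart_map_def edge_map_def)+

text \<open>
  This makes a boundary walk a continuous loop: the index is cyclic because the last dart of a closed
  walk ends where the first one starts.
\<close>

lemma closed_walk_cyclic:
  assumes "closed_walk G u p" "i < length p"
  shows "head (dart_graph G) (p ! i) = tail (dart_graph G) (p ! (Suc i mod length p))"
proof -
  have *: "pre_digraph.cas (dart_graph G) u p w \<Longrightarrow> i < length p \<Longrightarrow>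
      tail (dart_graph G) (p ! 0) = u \<and>
      head (dart_graph G) (p ! i) = (if Suc i = length p then w else tail (dart_graph G) (p ! Suc i))"
    for w i
  proof (induction p arbitrary: u i)
    case (Cons d p)
    have cas: "tail (dart_graph G) d = u" "pre_digraph.cas (dart_graph G) (head (dart_graph G) d) p w"
      using Cons.prems by (simp_all add: pre_digraph.cas.simps)
    show ?case
    proof (cases i)
      case 0
      show ?thesis
      proof (cases "p = []")
        case False
        then show ?thesis using Cons.IH[OF cas(2), of 0] cas 0 by auto
      qed (use cas 0 in \<open>simp add: pre_digraph.cas.simps\<close>)
    next
      case (Suc j)
      then show ?thesis using Cons.IH[OF cas(2), of j] cas Cons.prems by auto
    qed
  qed simp
  have "pre_digraph.cas (dart_graph G) u p u"
    using assms by (simp add: closed_walk_def pre_digraph.awalk_def)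
  from *[OF this, of i] *[OF this, of 0] assms(2) show ?thesis
    by (cases "Suc i = length p") auto
qed

section \<open>Closed cells in the glued space\<close>

locale glued_complex = wf_digraph G for G :: "('v, 'e) pre_digraph" +
  fixes F :: "'f set" and B :: "('v, 'e, 'f) boundary"
  assumes boundary_closed: "f \<in> F \<Longrightarrow> closed_walk G (fst (B f)) (snd (B f))"
begin

lemma edge_map_in: "e \<in> arcs G \<Longrightarrow> t \<in> {0..1} \<Longrightarrow> edge_map G e t \<in> cell_points G X"
  by (auto simp: edge_map_def cell_points_def)

lemma dart_map_in: "d \<in> arcs (dart_graph G) \<Longrightarrow> t \<in> {0..1} \<Longrightarrow> dart_map G d t \<in> cell_points G X"
  by (cases d) (auto simp: dart_map_def intro!: edge_map_in)

lemma walk_map_in: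
  assumes "closed_walk G u p" "0 \<le> s" "s < 1"
  shows "walk_map G (u, p) s \<in> cell_points G X"
proof (cases "p = []")
  case True
  then show ?thesis using assms
    by (auto simp: walk_map_def closed_walk_def pre_digraph.awalk_def cell_points_def)
next
  case False
  let ?n = "real (length p)"
  have "s * ?n < ?n" "0 \<le> s * ?n" using assms False by auto
  then have "nat \<lfloor>s * ?n\<rfloor> < length p" by linarith
  then have "p ! nat \<lfloor>s * ?n\<rfloor> \<in> set p" by (rule nth_mem)
  then have "p ! nat \<lfloor>s * ?n\<rfloor> \<in> arcs (dart_graph G)"
    using assms(1) unfolding closed_walk_def pre_digraph.awalk_def by (metis subsetD)
  moreover have "frac (s * ?n) \<in> {0..1}"
    using frac_ge_0[of "s * ?n"] frac_lt_1[of "s * ?n"] by simp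
  ultimately have "dart_map G (p ! nat \<lfloor>s * ?n\<rfloor>) (frac (s * ?n)) \<in> cell_points G X"
    by (rule dart_map_in)
  then show ?thesis using False by (simp add: walk_map_def)
qed

lemma face_map_in:
  assumes "f \<in> F" "z \<in> cball 0 1"
  shows "face_map G B f z \<in> cell_points G F"
proof (cases "norm z < 1")
  case False
  have "0 \<le> Arg2pi z / (2 * pi)" "Arg2pi z / (2 * pi) < 1"
    using Arg2pi_ge_0[of z] Arg2pi_lt_2pi[of z] by auto
  then have "walk_map G (B f) (Arg2pi z / (2 * pi)) \<in> cell_points G F"
    using walk_map_in[OF boundary_closed[OF assms(1)], where X = F] by simp
  then show ?thesis using False by (simp add: face_map_def)
qed (use assms in \<open>auto simp: face_map_def cell_points_def\<close>)

lemma topspace_realization: "topspace (realization G F B) = cell_points G F"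
proof
  show "topspace (realization G F B) \<subseteq> cell_points G F"
    by (rule openin_realization[THEN iffD1, OF openin_topspace, THEN conjunct1])
  have "{t \<in> {0..1}. edge_map G e t \<in> cell_points G F} = {0..1}" if "e \<in> arcs G" for e
    using edge_map_in[OF that, where X = F] by auto
  moreover have "{z \<in> cball 0 1. face_map G B f z \<in> cell_points G F} = cball 0 1" if "f \<in> F" for f
    using face_map_in[OF that] by auto
  ultimately have "openin (realization G F B) (cell_points G F)"
    by (simp add: openin_realization)
  then show "cell_points G F \<subseteq> topspace (realization G F B)" by (rule openin_subset)
qed

text \<open>The quotient topology makes the characteristic maps of the closed cells continuous.\<close>

lemma continuous_edge_map:
  "e \<in> arcs G \<Longrightarrow> continuous_map (top_of_set {0..1}) (realization G F B) (edge_map G e)"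
  unfolding continuous_map_def
  by (simp add: topspace_realization openin_realization edge_map_in Pi_iff)

lemma continuous_face_map:
  "f \<in> F \<Longrightarrow> continuous_map (top_of_set (cball 0 1)) (realization G F B) (face_map G B f)"
  unfolding continuous_map_def
  by (simp add: topspace_realization openin_realization face_map_in Pi_iff)

lemma connectedin_dart:
  assumes "d \<in> arcs (dart_graph G)"
  shows "connectedin (realization G F B) (dart_map G d ` {0..1})"
proof -
  obtain e s where d: "d = (e, s)" by force
  have flip: "(\<lambda>t. 1 - t) ` {0..1} = {0..1::real}"
    by simp
  have "(dart_map G d :: real \<Rightarrow> ('v, 'e, 'f) point) = edge_map G e \<circ> (if s then id else (\<lambda>t. 1 - t))"
    by (rule ext) (simp add: d dart_map_def)
  then have "(dart_map G d ` {0..1} :: ('v, 'e, 'f) point set) = edge_map G e ` ((if s then id else (\<lambda>t. 1 - t)) ` {0..1})"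
    by (simp only: image_comp)
  also have "\<dots> = edge_map G e ` {0..1}"
    by (cases s) (simp_all only: if_True if_False flip image_id id_apply)
  finally have "(dart_map G d ` {0..1} :: ('v, 'e, 'f) point set) = edge_map G e ` {0..1}" .
  moreover have "connectedin (top_of_set {0..1}) {0..1::real}"
    by (simp add: connectedin_subtopology)
  ultimately show ?thesis
    using connectedin_continuous_map_image[OF continuous_edge_map] assms d by auto
qed

lemma connectedin_face:
  assumes "f \<in> F"
  shows "connectedin (realization G F B) (face_map G B f ` cball 0 1)"
proof -
  have "connectedin (top_of_set (cball 0 1)) (cball 0 1 :: complex set)"
    by (simp add: connectedin_subtopology)
  then show ?thesis
    using connectedin_continuous_map_image[OF continuous_face_map[OF assms]] by blast
qed

text \<open>
  Traversing a walk joins one closed edge to the next at a common vertex, so the points of a walk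
  form a connected set that stays in the graph whichever faces \<open>X\<close> are glued in.
\<close>

lemma connectedin_walk:
  fixes X :: "'f set"
  assumes "pre_digraph.awalk (dart_graph G) u p w"
  shows "connectedin (realization G F B) (walk_points G (u, p)) \<and>
    walk_points G (u, p) \<subseteq> cell_points G X \<and> (Vertex w :: ('v, 'e, 'f) point) \<in> walk_points G (u, p)"
  using assms
proof (induction p arbitrary: u)
  case Nil
  then show ?case
    by (auto simp: walk_points_def pre_digraph.awalk_def pre_digraph.cas.simps
        topspace_realization cell_points_def)
next
  case (Cons d p)
  let ?x = "head (dart_graph G) d"
  have u: "tail (dart_graph G) d = u" and d: "d \<in> arcs (dart_graph G)"
    using Cons.prems by (auto simp: pre_digraph.awalk_def pre_digraph.cas.simps)
  have "?x \<in> verts (dart_graph G)"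
    using wf_digraph.head_in_verts[OF wf_dart_graph[OF wf_digraph_axioms] d] .
  then have "pre_digraph.awalk (dart_graph G) ?x p w"
    using Cons.prems by (auto simp: pre_digraph.awalk_def pre_digraph.cas.simps)
  note IH = Cons.IH[OF this]
  let ?D = "dart_map G d ` {0..1} :: ('v, 'e, 'f) point set"
  have "dart_map G d 0 \<in> ?D" "dart_map G d 1 \<in> ?D"
    by (rule imageI; simp)+
  then have ends: "Vertex u \<in> ?D" "Vertex ?x \<in> ?D"
    by (simp_all add: u)
  then have eq: "walk_points G (u, d # p) = ?D \<union> walk_points G (?x, p)"
    by (auto simp: walk_points_def)
  have "(Vertex ?x :: ('v, 'e, 'f) point) \<in> walk_points G (?x, p)" by (simp add: walk_points_def)
  with ends have "?D \<inter> walk_points G (?x, p) \<noteq> {}" by blast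
  then have "connectedin (realization G F B) (walk_points G (u, d # p))"
    unfolding eq using IH connectedin_Un[OF connectedin_dart[OF d]] by simp
  moreover have "?D \<subseteq> cell_points G X"
    by (intro image_subsetI dart_map_in d)
  ultimately show ?case using IH by (simp add: eq)
qed

end

section \<open>Subcomplexes are closed\<close>

text \<open>
  The subgraph \<open>H\<close> uses the end maps of \<open>G\<close> itself, so that cells of \<open>H\<close> have the same
  characteristic maps as in \<open>G\<close>. That \<open>(H, F')\<close> is again a glued complex says that the chosen faces
  are bounded by walks inside \<open>H\<close>.
\<close>

locale subcomplex = glued_complex G F B + sub: glued_complex H F' B
  for G :: "('v, 'e) pre_digraph" and F :: "'f set" and B :: "('v, 'e, 'f) boundary"
    and H :: "('v, 'e) pre_digraph" and F' :: "'f set" +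
  assumes verts_sub: "verts H \<subseteq> verts G" and arcs_sub: "arcs H \<subseteq> arcs G"
    and tail_sub: "tail H = tail G" and head_sub: "head H = head G" and faces_sub: "F' \<subseteq> F"
begin

lemma edge_map_sub: "edge_map H = edge_map G"
  by (intro ext) (simp add: edge_map_def tail_sub head_sub)

lemma dart_map_sub: "dart_map H = dart_map G"
  by (intro ext) (simp add: dart_map_def edge_map_sub)

lemma face_map_sub: "face_map H B = face_map G B"
proof -
  have "(walk_map H :: _ \<Rightarrow> _ \<Rightarrow> ('v, 'e, 'f) point) = walk_map G"
    by (intro ext) (simp add: walk_map_def dart_map_sub split: prod.split)
  then show ?thesis by (intro ext) (simp add: face_map_def)
qed

lemma points_sub: "cell_points H F' \<subseteq> cell_points G F"
  using verts_sub arcs_sub faces_sub by (auto simp: cell_points_def)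

text \<open>
  A closed edge lies in the subcomplex as a whole, or meets it at most in its two ends.
\<close>

lemma closed_dart_preimage:
  "closed {t \<in> {0..1}. dart_map G d t \<in> (cell_points H F' :: ('v, 'e, 'f) point set)}" (is "closed ?T")
proof (cases "fst d \<in> arcs H")
  case True
  then have "d \<in> arcs (dart_graph H)" by (cases d) simp
  then have "dart_map G d t \<in> cell_points H F'" if "t \<in> {0..1}" for t
    using sub.dart_map_in[of d t F'] that by (simp only: dart_map_sub)
  then have "?T = {0..1}" by auto
  then show ?thesis by simp
next
  case False
  then have "?T \<subseteq> {0, 1}"
    by (cases d) (auto simp: dart_map_def edge_map_def cell_points_def split: if_splits)
  then show ?thesis by (meson finite.emptyI finite.insertI finite_imp_closed finite_subset)
qed

text \<open>
  The preimage in the bounding circle of a face is the image, under the compact parametrization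
  \<open>s \<mapsto> exp (2 \<pi> \<i> s)\<close> of the circle, of the finitely many preimages in the closed darts of the
  boundary walk. The parameter \<open>s\<close> runs through the closed unit interval, while the angle of
  \<^const>\<open>walk_map\<close> is taken in \<open>[0, 1)\<close>; the two agree at the end of each dart because consecutive darts
  share a vertex.
\<close>

lemma closed_boundary_preimage:
  assumes walk: "closed_walk G u p"
  shows "closed {z. norm z = 1 \<and>
    walk_map G (u, p) (Arg2pi z / (2 * pi)) \<in> (cell_points H F' :: ('v, 'e, 'f) point set)}"
    (is "closed {z. norm z = 1 \<and> ?w z \<in> ?X}")
proof (cases "p = []")
  case True
  have sphere: "{z :: complex. norm z = 1} = sphere 0 1" by auto
  show ?thesis using True by (cases "Vertex u \<in> ?X") (simp_all add: walk_map_def sphere)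
next
  case False
  define n where "n = length p"
  have n: "n > 0" using False by (simp add: n_def)
  \<comment> \<open>\<open>D i\<close> is the part of the \<open>i\<close>-th dart that maps into the subcomplex, \<open>T\<close> its position on the walk.\<close>
  define D where "D = (\<lambda>i. {t \<in> {0..1}. dart_map G (p ! i) t \<in> ?X})"
  define T where "T = (\<Union>i<n. (\<lambda>t. (real i + t) / real n) ` D i)"
  have "compact (D i)" for i
  proof -
    have "D i \<subseteq> {0..1}" by (auto simp: D_def)
    then have "bounded (D i)" using bounded_subset bounded_closed_interval by blast
    moreover have "closed (D i)" unfolding D_def by (rule closed_dart_preimage)
    ultimately show ?thesis by (simp add: compact_eq_bounded_closed)
  qed
  then have "compact T"
    unfolding T_def by (intro compact_UN compact_continuous_image continuous_intros) (use n in auto)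
  moreover have "{z. norm z = 1 \<and> ?w z \<in> ?X} = (\<lambda>s. exp (\<i> * of_real (2 * pi * s))) ` T"
  proof (intro Set.set_eqI iffI)
    fix z assume z: "z \<in> {z. norm z = 1 \<and> ?w z \<in> ?X}"
    define s where "s = Arg2pi z / (2 * pi)"
    have s: "0 \<le> s" "s < 1" using Arg2pi_ge_0[of z] Arg2pi_lt_2pi[of z] by (auto simp: s_def)
    define i where "i = nat \<lfloor>s * n\<rfloor>"
    have sn: "s * n < n" "0 \<le> s * n" using s n by auto
    then have i: "i < n" "real i + frac (s * n) = s * n" unfolding i_def frac_def by (linarith, simp)
    have "?w z = dart_map G (p ! i) (frac (s * n))"
      using False by (simp add: walk_map_def s_def n_def i_def)
    then have "frac (s * n) \<in> D i"
      using z frac_ge_0[of "s * n"] frac_lt_1[of "s * n"] by (simp add: D_def)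
    then have "(real i + frac (s * n)) / n \<in> T" using i(1) unfolding T_def by blast
    then have "s \<in> T" using i(2) n by simp
    moreover have "z = exp (\<i> * of_real (2 * pi * s))"
      using z complex_norm_eq_1_exp[of z] by (simp add: s_def)
    ultimately show "z \<in> (\<lambda>s. exp (\<i> * of_real (2 * pi * s))) ` T" by blast
  next
    fix z assume "z \<in> (\<lambda>s. exp (\<i> * of_real (2 * pi * s))) ` T"
    then obtain i t where i: "i < n" and t: "t \<in> D i"
      and z: "z = exp (\<i> * of_real (2 * pi * ((real i + t) / n)))"
      unfolding T_def by blast
    have norm: "norm z = 1" unfolding z by (simp add: norm_exp_i_times)
    have t01: "0 \<le> t" "t \<le> 1" "dart_map G (p ! i) t \<in> ?X" using t by (auto simp: D_def)
    have arg: "Arg2pi (exp (\<i> * of_real (2 * pi * s))) = 2 * pi * s" if "0 \<le> s" "s < 1" for s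
      by (rule Arg2pi_unique[of 1]) (use that in auto)
    have start: "?w (exp (\<i> * of_real (2 * pi * ((real j + t') / n)))) = dart_map G (p ! j) t'"
      if j: "j < n" and t': "0 \<le> t'" "t' < 1" for j t'
    proof -
      have "real j + t' < n" using j t' by linarith
      then have "0 \<le> (real j + t') / n" "(real j + t') / n < 1" using t' n by auto
      from arg[OF this] have "Arg2pi (exp (\<i> * of_real (2 * pi * ((real j + t') / n)))) / (2 * pi)
          = (real j + t') / n" by simp
      moreover have "\<lfloor>real j + t'\<rfloor> = int j" using t' by linarith
      moreover have "frac (real j + t') = t'" using t' calculation(2) by (simp add: frac_def)
      ultimately show ?thesis using False n by (simp add: walk_map_def n_def[symmetric])
    qed
    show "z \<in> {z. norm z = 1 \<and> ?w z \<in> ?X}"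
    proof (cases "t < 1")
      case True
      then show ?thesis using start[OF i t01(1) True] t01 norm by (simp add: z)
    next
      case False
      \<comment> \<open>The end of the dart \<open>i\<close> is the start of the next dart \<open>j\<close>, the first one if \<open>i\<close> is the last.\<close>
      then have t1: "t = 1" using t01 by simp
      define j where "j = Suc i mod n"
      have "exp (\<i> * of_real (2 * pi * ((real i + 1) / n))) = exp (\<i> * of_real (2 * pi * ((real j + 0) / n)))"
      proof (cases "Suc i = n")
        case True
        then have "(real i + 1) / n = 1" "j = 0" using n by (auto simp: j_def)
        then show ?thesis using exp_two_pi_i by (simp add: ac_simps)
      next
        case False
        then have "j = Suc i" using i by (simp add: j_def)
        then show ?thesis by (simp add: add.commute)
      qed
      then have "?w z = dart_map G (p ! j) 0"
        using start[of j 0] n unfolding z t1 by (simp add: j_def)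
      also have "\<dots> = dart_map G (p ! i) 1"
        using closed_walk_cyclic[OF walk, of i] i by (simp add: j_def n_def)
      finally show ?thesis using t01 norm by (simp add: t1)
    qed
  qed
  ultimately have "compact {z. norm z = 1 \<and> ?w z \<in> ?X}"
    by (simp only:) (intro compact_continuous_image continuous_intros)
  then show ?thesis by (rule compact_imp_closed)
qed

text \<open>
  In the quotient topology it suffices to look at one closed cell at a time. A cell of the subcomplex
  lies in it entirely; any other closed edge or face meets it only in its boundary, where the two
  preceding lemmas apply.
\<close>

lemma closedin_subcomplex: "closedin (realization G F B) (cell_points H F')"
proof -
  let ?X = "cell_points H F'"
  have "openin (top_of_set {0..1}) {t \<in> {0..1}. edge_map G e t \<in> cell_points G F - ?X}"
    if "e \<in> arcs G" for e
  proof -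
    let ?P = "{t \<in> {0..1}. dart_map G (e, True) t \<in> ?X}"
    have "closedin (top_of_set {0..1}) ?P"
      by (rule closed_subset[OF _ closed_dart_preimage]) blast
    then have "openin (top_of_set {0..1}) ({0..1} - ?P)"
      by (rule openin_diff[OF openin_subtopology_self])
    moreover have "dart_map G (e, True) t = (edge_map G e t :: ('v, 'e, 'f) point)" for t
      by (simp add: dart_map_def)
    moreover have "edge_map G e t \<in> cell_points G F" if "t \<in> {0..1}" for t
      using edge_map_in \<open>e \<in> arcs G\<close> that .
    ultimately show ?thesis
      by (simp add: set_diff_eq cong: conj_cong)
  qed
  moreover have "openin (top_of_set (cball 0 1)) {z \<in> cball 0 1. face_map G B f z \<in> cell_points G F - ?X}"
    if f: "f \<in> F" for f
  proof -
    let ?P = "{z \<in> cball 0 1. face_map G B f z \<in> ?X}"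
    have "closed ?P"
    proof (cases "f \<in> F'")
      case True
      then have "?P = cball 0 1"
        using sub.face_map_in[OF True] unfolding face_map_sub by auto
      then show ?thesis by simp
    next
      case False
      then have "?P = {z. norm z = 1 \<and> walk_map G (B f) (Arg2pi z / (2 * pi)) \<in> ?X}"
        by (auto simp: face_map_def cell_points_def)
      then show ?thesis using closed_boundary_preimage[OF boundary_closed[OF f]] by simp
    qed
    moreover have "{z \<in> cball 0 1. face_map G B f z \<in> cell_points G F - ?X} = cball 0 1 - ?P"
      using face_map_in[OF f] by auto
    moreover have "closedin (top_of_set (cball 0 1)) ?P"
      by (rule closed_subset[OF _ \<open>closed ?P\<close>]) blast
    ultimately show ?thesis
      using openin_diff[OF openin_subtopology_self] by simp
  qed
  ultimately have "openin (realization G F B) (cell_points G F - ?X)"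
    by (simp add: openin_realization)
  then show ?thesis using points_sub by (simp add: closedin_def topspace_realization)
qed

end

section \<open>Components of a subcomplex\<close>

text \<open>
  Meant for predicates \<open>P\<close> that hold at both ends of an edge or at neither, so that testing the tail
  decides for the edge.
\<close>

definition restrict_graph :: "('v, 'e) pre_digraph \<Rightarrow> ('v \<Rightarrow> bool) \<Rightarrow> ('v, 'e) pre_digraph" where
  "restrict_graph H P = H\<lparr>verts := {w \<in> verts H. P w}, arcs := {e \<in> arcs H. P (tail H e)}\<rparr>"

lemma restrict_graph_simps [simp]:
  "verts (restrict_graph H P) = {w \<in> verts H. P w}"
  "arcs (restrict_graph H P) = {e \<in> arcs H. P (tail H e)}"
  "tail (restrict_graph H P) = tail H"
  "head (restrict_graph H P) = head H"
  by (simp_all add: restrict_graph_def)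

lemma awalk_restrict_graph:
  assumes P: "\<And>e. e \<in> arcs H \<Longrightarrow> P (tail H e) \<longleftrightarrow> P (head H e)"
    and walk: "pre_digraph.awalk (dart_graph H) u p w" and u: "P u"
  shows "pre_digraph.awalk (dart_graph (restrict_graph H P)) u p w"
proof -
  have *: "set p \<subseteq> arcs (dart_graph (restrict_graph H P))"
    if "set p \<subseteq> arcs (dart_graph H)" "pre_digraph.cas (dart_graph H) u p w" "P u" for u
    using that
  proof (induction p arbitrary: u)
    case (Cons d p)
    obtain e s where d: "d = (e, s)" by force
    have e: "e \<in> arcs H" and tail: "tail (dart_graph H) d = u"
      and cas: "pre_digraph.cas (dart_graph H) (head (dart_graph H) d) p w"
      using Cons.prems d by (auto simp: pre_digraph.cas.simps)
    have "P (head (dart_graph H) d)" "P (tail H e)"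
      using P[OF e] Cons.prems(3) tail by (auto simp: d split: if_splits)
    with Cons.IH[OF _ cas] Cons.prems(1) e d show ?case by simp
  qed simp
  have "set p \<subseteq> arcs (dart_graph H)" "pre_digraph.cas (dart_graph H) u p w" "u \<in> verts H"
    using walk by (simp_all add: pre_digraph.awalk_def)
  with *[OF this(1,2) u] show ?thesis
    using u cas_dart_cong[of "restrict_graph H P" H] by (simp add: pre_digraph.awalk_def)
qed

context subcomplex
begin

lemma subcomplex_restrict:
  assumes P: "\<And>e. e \<in> arcs H \<Longrightarrow> P (tail H e) \<longleftrightarrow> P (head H e)"
  shows "subcomplex G F B (restrict_graph H P) {f \<in> F'. P (fst (B f))}"
proof
  show "tail (restrict_graph H P) e \<in> verts (restrict_graph H P)"
    "head (restrict_graph H P) e \<in> verts (restrict_graph H P)"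
    if "e \<in> arcs (restrict_graph H P)" for e
    using that P sub.wellformed by auto
  show "closed_walk (restrict_graph H P) (fst (B f)) (snd (B f))" if "f \<in> {f \<in> F'. P (fst (B f))}" for f
    using that sub.boundary_closed[of f] awalk_restrict_graph[of H P, OF P]
    by (simp add: closed_walk_def)
qed (use verts_sub arcs_sub tail_sub head_sub faces_sub in auto)

text \<open>
  A set of vertices closed under adjacency cuts the subcomplex into two disjoint subcomplexes, and
  these are closed, so no connected set meets both.
\<close>

lemma connectedin_same_part:
  assumes P: "\<And>e. e \<in> arcs H \<Longrightarrow> P (tail H e) \<longleftrightarrow> P (head H e)"
    and T: "connectedin (realization G F B) T" "T \<subseteq> cell_points H F'"
    and u: "Vertex u \<in> T" "P u" and w: "Vertex w \<in> T"
  shows "P w"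
proof (rule ccontr)
  assume "\<not> P w"
  let ?X = "\<lambda>P. cell_points (restrict_graph H P) {f \<in> F'. P (fst (B f))}"
  let ?Q = "\<lambda>x. \<not> P x"
  interpret part: subcomplex G F B "restrict_graph H P" "{f \<in> F'. P (fst (B f))}"
    using P by (rule subcomplex_restrict)
  interpret rest: subcomplex G F B "restrict_graph H ?Q" "{f \<in> F'. ?Q (fst (B f))}"
    by (rule subcomplex_restrict) (use P in blast)
  have "x \<in> ?X P \<union> ?X ?Q" if "x \<in> cell_points H F'" for x
    using that by (cases x) (auto simp: cell_points_def)
  then have "T \<subseteq> ?X P \<union> ?X ?Q" using T(2) by blast
  moreover have "?X P \<inter> ?X ?Q \<inter> T = {}" by (auto simp: cell_points_def)
  moreover have "Vertex u \<in> ?X P \<inter> T" "Vertex w \<in> ?X ?Q \<inter> T"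
    using u w \<open>\<not> P w\<close> T(2) by (auto simp: cell_points_def)
  ultimately show False
    using T(1) part.closedin_subcomplex rest.closedin_subcomplex unfolding connectedin_closedin by blast
qed

abbreviation component :: "('v, 'e, 'f) point \<Rightarrow> ('v, 'e, 'f) point set" where
  "component \<equiv> connected_component_of_set (subtopology (realization G F B) (cell_points H F'))"

lemma in_component:
  assumes "connectedin (realization G F B) T" "T \<subseteq> cell_points H F'" "x \<in> T" "y \<in> T"
  shows "y \<in> component x"
  using assms unfolding connected_component_of_def by (auto simp: connectedin_subtopology)

lemma walk_points_in_component:
  assumes "pre_digraph.awalk (dart_graph H) u p w"
  shows "walk_points G (u, p) \<subseteq> component (Vertex u)" "Vertex w \<in> component (Vertex u)"
proof -
  have "pre_digraph.awalk (dart_graph G) u p w"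
    using assms verts_sub arcs_sub cas_dart_cong[OF tail_sub head_sub]
    by (auto simp: pre_digraph.awalk_def)
  from connectedin_walk[OF this]
  have conn: "connectedin (realization G F B) (walk_points G (u, p))" by blast
  have "(walk_points G (u, p) :: ('v, 'e, 'f) point set) = walk_points H (u, p)"
    by (simp add: walk_points_def dart_map_sub)
  then have sub: "walk_points G (u, p) \<subseteq> cell_points H F'" "(Vertex w :: ('v, 'e, 'f) point) \<in> walk_points G (u, p)"
    using sub.connectedin_walk[OF assms, of F'] by auto
  have "Vertex u \<in> walk_points G (u, p)" by (simp add: walk_points_def)
  from in_component[OF conn sub(1) this] sub(2)
  show "walk_points G (u, p) \<subseteq> component (Vertex u)" "Vertex w \<in> component (Vertex u)" by blast+
qed

text \<open>
  Topological components of a subcomplex are the components of its graph. A walk is a connected set.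
  Conversely, the vertices reachable from \<open>u\<close> are closed under adjacency, because every edge
  carries darts in both directions; so a connected set cannot leave them.
\<close>

theorem component_iff_reachable:
  assumes "u \<in> verts H" "w \<in> verts H"
  shows "Vertex w \<in> component (Vertex u) \<longleftrightarrow> u \<rightarrow>\<^sup>*\<^bsub>dart_graph H\<^esub> w"
proof
  interpret darts: wf_digraph "dart_graph H" by (rule wf_dart_graph) unfold_locales
  show "Vertex w \<in> component (Vertex u)" if "u \<rightarrow>\<^sup>*\<^bsub>dart_graph H\<^esub> w"
    using that walk_points_in_component(2) by (auto simp: darts.reachable_awalk)
  show "u \<rightarrow>\<^sup>*\<^bsub>dart_graph H\<^esub> w" if in_comp: "Vertex w \<in> component (Vertex u)"
  proof -
    obtain T where T: "connectedin (realization G F B) T" "T \<subseteq> cell_points H F'"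
      "Vertex u \<in> T" "Vertex w \<in> T"
      using in_comp by (auto simp: connected_component_of_def connectedin_subtopology)
    let ?P = "\<lambda>x. u \<rightarrow>\<^sup>*\<^bsub>dart_graph H\<^esub> x"
    have adj: "tail H e \<rightarrow>\<^bsub>dart_graph H\<^esub> head H e" "head H e \<rightarrow>\<^bsub>dart_graph H\<^esub> tail H e"
      if "e \<in> arcs H" for e
      using that darts.in_arcs_imp_in_arcs_ends[of "(e, True)"]
        darts.in_arcs_imp_in_arcs_ends[of "(e, False)"] by simp_all
    have "?P (tail H e) \<longleftrightarrow> ?P (head H e)" if "e \<in> arcs H" for e
      using adj[OF that] darts.reachable_adj_trans by blast
    from connectedin_same_part[of ?P, OF this T(1,2,3) _ T(4)] show ?thesis
      using assms(1) by simp
  qed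
qed

text \<open>
  Every point is joined to a vertex inside a closed cell, so components can be counted on vertices
  alone. For a face the vertex is the base of its boundary walk, the image of \<open>1\<close> under the
  characteristic map.
\<close>

lemma component_has_vertex:
  assumes "x \<in> cell_points H F'"
  obtains u where "u \<in> verts H" "x \<in> component (Vertex u)"
proof -
  consider (vertex) u where "u \<in> verts H" "x = Vertex u"
    | (edge) e t where "e \<in> arcs H" "0 < t" "t < 1" "x = EdgePt e t"
    | (face) f z where "f \<in> F'" "norm z < 1" "x = FacePt f z"
    using assms by (auto simp: cell_points_def)
  then show thesis
  proof cases
    case vertex
    then have "connectedin (realization G F B) {x}"
      using assms points_sub by (auto simp: topspace_realization)
    then have "x \<in> component x" by (rule in_component) (use assms in auto)
    then show thesis using vertex that by blast
  next
    case edge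
    let ?d = "(e, True)"
    let ?D = "dart_map G ?d ` {0..1} :: ('v, 'e, 'f) point set"
    have "?d \<in> arcs (dart_graph G)" using edge arcs_sub by auto
    note conn = connectedin_dart[OF this]
    have "?D \<subseteq> cell_points H F'"
      using sub.dart_map_in[of ?d _ F'] edge(1) unfolding dart_map_sub by auto
    moreover have "x \<in> ?D"
      by (rule image_eqI[of _ _ t]) (use edge in \<open>auto simp: dart_map_def edge_map_def\<close>)
    moreover have "Vertex (tail G e) \<in> ?D"
      by (rule image_eqI[of _ _ 0]) auto
    ultimately have "x \<in> component (Vertex (tail G e))" using in_component[OF conn] by blast
    then show thesis using that sub.wellformed(1)[OF edge(1)] by (simp add: tail_sub)
  next
    case face
    let ?D = "face_map G B f ` cball 0 1"
    have walk: "closed_walk H (fst (B f)) (snd (B f))" using face sub.boundary_closed by blast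
    then have u: "fst (B f) \<in> verts H" by (simp add: closed_walk_def pre_digraph.awalk_def)
    have conn: "connectedin (realization G F B) ?D" using face faces_sub connectedin_face by blast
    have "?D \<subseteq> cell_points H F'"
      using sub.face_map_in[OF face(1)] by (auto simp: face_map_sub)
    moreover have "x = face_map G B f z" using face by (simp add: face_map_def)
    moreover have "Vertex (fst (B f)) = face_map G B f 1"
    proof (cases "B f")
      case (Pair u p)
      have "Arg2pi 1 = 0" using Arg2pi_of_real[of 1] by simp
      then show ?thesis
        using walk Pair tail_sub head_sub cas_dart_cong[OF tail_sub head_sub]
        by (cases p) (auto simp: face_map_def walk_map_def closed_walk_def pre_digraph.awalk_def
            pre_digraph.cas.simps)
    qed
    ultimately have "x \<in> component (Vertex (fst (B f)))"
      using in_component[OF conn] face(2) by auto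
    then show thesis using that u by blast
  qed
qed

end

section \<open>Counting left cosets\<close>

lemma (in group) card_l_coset:
  assumes "a \<in> carrier G" "K \<subseteq> carrier G"
  shows "card (a <# K) = card K"
proof -
  have "a <# K = (\<lambda>k. a \<otimes> k) ` K" by (auto simp: l_coset_def)
  then show ?thesis using inj_on_g'[OF assms(2,1)] by (simp add: card_image)
qed

text \<open>
  All four counts have this form. If \<open>f\<close> separates exactly the left cosets of \<open>K\<close>, then it takes
  \<open>[H : K]\<close> values on any left coset of a subgroup \<open>H\<close> that contains \<open>K\<close>.
\<close>

lemma (in group) card_image_l_coset:
  assumes "finite (carrier G)" and H: "subgroup H G" and K: "subgroup K G" and sub: "K \<subseteq> H"
    and a: "a \<in> carrier G"
    and f: "\<And>b b'. b \<in> carrier G \<Longrightarrow> b' \<in> carrier G \<Longrightarrow> f b = f b' \<longleftrightarrow> b' \<in> b <# K"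
  shows "card (f ` (a <# H)) * card K = card H"
proof -
  have carr: "a <# H \<subseteq> carrier G" using a subgroup.subset[OF H] by (auto simp: l_coset_def)
  then have fin: "finite (a <# H)" using assms(1) finite_subset by blast
  have fibre: "card {b' \<in> a <# H. f b' = y} = card K" if y: "y \<in> f ` (a <# H)" for y
  proof -
    obtain b where b: "b \<in> a <# H" "y = f b" using y by blast
    then obtain x where x: "x \<in> H" "b = a \<otimes> x" by (auto simp: l_coset_def)
    have bc: "b \<in> carrier G" using b carr by blast
    have "b <# K \<subseteq> a <# H"
    proof
      fix b' assume "b' \<in> b <# K"
      then obtain k where k: "k \<in> K" "b' = b \<otimes> k" by (auto simp: l_coset_def)
      then have "x \<otimes> k \<in> H" using x sub subgroup.m_closed[OF H] by blast
      moreover have "b' = a \<otimes> (x \<otimes> k)"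
        using x k a sub subgroup.mem_carrier[OF H] m_assoc by (metis subsetD)
      ultimately show "b' \<in> a <# H" by (auto simp: l_coset_def)
    qed
    moreover have "f b' = y \<longleftrightarrow> b' \<in> b <# K" if "b' \<in> a <# H" for b'
      using f[OF bc, of b'] that carr b(2) by auto
    ultimately have "{b' \<in> a <# H. f b' = y} = b <# K" by blast
    then show ?thesis using card_l_coset[OF bc subgroup.subset[OF K]] by simp
  qed
  have "card H = card (a <# H)" using card_l_coset[OF a subgroup.subset[OF H]] by simp
  also have "\<dots> = (\<Sum>y\<in>f ` (a <# H). card {b' \<in> a <# H. f b' = y})"
    using sum.image_gen[OF fin, of "\<lambda>_. 1 :: nat" f] by simp
  also have "\<dots> = card (f ` (a <# H)) * card K" using fibre by simp
  finally show ?thesis by simp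
qed

lemma (in group)
  assumes "finite (carrier G)" "x \<in> carrier G"
  shows card_generate_pos: "card (generate G {x}) > 0"
    and pow_card_generate: "x [^] card (generate G {x}) = \<one>"
    and generate_eq_powers: "generate G {x} = (\<lambda>i. x [^] i) ` {..<card (generate G {x})}"
proof -
  have ord: "ord x = card (generate G {x})" using generate_pow_card[OF assms(2)] by simp
  have "ord x > 0" using ord_ge_1[OF assms] by simp
  then show "card (generate G {x}) > 0" by (simp add: ord)
  show "x [^] card (generate G {x}) = \<one>" using pow_ord_eq_1[OF assms(2)] by (simp add: ord)
  have "generate G {x} = {x [^] k | k. k \<in> (UNIV :: nat set)}"
    using generate_pow_nat[OF assms(2)] \<open>ord x > 0\<close> by simp
  also have "\<dots> = {x [^] k | k. k \<in> {0 .. ord x - 1}}"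
    using ord_elems[OF assms] by simp
  also have "\<dots> = (\<lambda>i. x [^] i) ` {..<ord x}" using \<open>ord x > 0\<close> by force
  finally show "generate G {x} = (\<lambda>i. x [^] i) ` {..<card (generate G {x})}" by (simp add: ord)
qed

section \<open>Lifting walks to the derived graph\<close>

lemma derived_graph_simps [simp]:
  "verts (derived_graph G A \<alpha>) = verts G \<times> carrier A"
  "arcs (derived_graph G A \<alpha>) = arcs G \<times> carrier A"
  "tail (derived_graph G A \<alpha>) (e, a) = (tail G e, a)"
  "head (derived_graph G A \<alpha>) (e, a) = (head G e, a \<otimes>\<^bsub>A\<^esub> \<alpha> (e, True))"
  by (simp_all add: derived_graph_def)

locale voltage_graph = wf_digraph G + group A
  for G :: "('v, 'e) pre_digraph" and A :: "('a, 'm) monoid_scheme" (structure) +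
  fixes \<alpha> :: "'e \<times> bool \<Rightarrow> 'a"
  assumes finite_carrier: "finite (carrier A)" and voltage: "voltage_assignment G A \<alpha>"
begin

lemma dart_voltage: "d \<in> arcs (dart_graph G) \<Longrightarrow> \<alpha> d \<in> carrier A"
  using voltage unfolding voltage_assignment_def by blast

lemma opposite_voltage: "d \<in> arcs (dart_graph G) \<Longrightarrow> \<alpha> (opposite d) = inv (\<alpha> d)"
  using voltage unfolding voltage_assignment_def by blast

lemma net_voltage_Nil [simp]: "net_voltage A \<alpha> [] = \<one>"
  and net_voltage_Cons [simp]: "net_voltage A \<alpha> (d # p) = \<alpha> d \<otimes> net_voltage A \<alpha> p"
  by (simp_all add: net_voltage_def)

lemma net_voltage_closed: "set p \<subseteq> arcs (dart_graph G) \<Longrightarrow> net_voltage A \<alpha> p \<in> carrier A"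
  by (induction p) (auto simp: dart_voltage simp del: dart_graph_simps)

lemma net_voltage_append:
  "set p \<subseteq> arcs (dart_graph G) \<Longrightarrow> set q \<subseteq> arcs (dart_graph G) \<Longrightarrow>
   net_voltage A \<alpha> (p @ q) = net_voltage A \<alpha> p \<otimes> net_voltage A \<alpha> q"
  by (induction p) (simp_all add: dart_voltage net_voltage_closed m_assoc del: dart_graph_simps)

lemma awalk_voltage_closed:
  "pre_digraph.awalk (dart_graph G) u p w \<Longrightarrow> net_voltage A \<alpha> p \<in> carrier A"
  using net_voltage_closed by (simp add: pre_digraph.awalk_def del: dart_graph_simps)

lemma wf_derived_graph: "wf_digraph (derived_graph G A \<alpha>)"
proof
  fix x assume "x \<in> arcs (derived_graph G A \<alpha>)"
  then obtain e a where x: "x = (e, a)" "e \<in> arcs G" "a \<in> carrier A" by auto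
  show "tail (derived_graph G A \<alpha>) x \<in> verts (derived_graph G A \<alpha>)"
    "head (derived_graph G A \<alpha>) x \<in> verts (derived_graph G A \<alpha>)"
    using x dart_voltage[of "(e, True)"] by auto
qed

text \<open>
  Each dart multiplies the fibre coordinate by its own voltage. This is built in for positive darts;
  a negative dart runs back along the edge that ends at the current vertex, and the voltage of that
  edge cancels against the voltage of the opposite dart.
\<close>

lemma awalk_lift:
  assumes "pre_digraph.awalk (dart_graph G) u p w" "a \<in> carrier A"
  shows "pre_digraph.awalk (dart_graph (derived_graph G A \<alpha>)) (u, a) (lift A \<alpha> a p)
    (w, a \<otimes> net_voltage A \<alpha> p)"
  using assms
proof (induction p arbitrary: u a)
  case Nil
  then show ?case by (auto simp: pre_digraph.awalk_def pre_digraph.cas.simps)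
next
  case (Cons d p)
  obtain e s where d: "d = (e, s)" by force
  let ?x = "head (dart_graph G) d"
  have u: "tail (dart_graph G) d = u" and arc: "d \<in> arcs (dart_graph G)" and e: "e \<in> arcs G"
    and p: "set p \<subseteq> arcs (dart_graph G)"
    using Cons.prems(1) d by (auto simp: pre_digraph.awalk_def pre_digraph.cas.simps)
  have "?x \<in> verts G" using e d by simp
  then have tl: "pre_digraph.awalk (dart_graph G) ?x p w"
    using Cons.prems(1) by (auto simp: pre_digraph.awalk_def pre_digraph.cas.simps)
  have \<alpha>: "\<alpha> (e, s) \<in> carrier A" "\<alpha> (e, True) \<in> carrier A" "\<alpha> (e, False) = inv (\<alpha> (e, True))" for s
    using dart_voltage[of "(e, s)"] dart_voltage[of "(e, True)"] opposite_voltage[of "(e, True)"] e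
    by (simp_all add: opposite_def)
  have "a \<otimes> \<alpha> d \<in> carrier A" using \<alpha>(1) Cons.prems(2) d by simp
  note IH = Cons.IH[OF tl this]
  have "a \<otimes> \<alpha> d \<otimes> net_voltage A \<alpha> p = a \<otimes> net_voltage A \<alpha> (d # p)"
    using Cons.prems(2) \<alpha>(1) net_voltage_closed[OF p] by (simp add: d m_assoc)
  moreover have "a \<otimes> \<alpha> (e, False) \<otimes> \<alpha> (e, True) = a"
    using Cons.prems(2) \<alpha>(2) by (simp add: \<alpha>(3) m_assoc)
  ultimately show ?case
    using IH u e \<alpha>(1) Cons.prems \<open>a \<otimes> \<alpha> d \<in> carrier A\<close>
    by (cases s) (auto simp: d pre_digraph.awalk_def pre_digraph.cas.simps)
qed

text \<open>
  Converse of the preceding lemma; the ends and the net voltage of the projected walk suffice to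
  decide which vertices of the derived graph are joined.
\<close>

lemma awalk_project:
  assumes "pre_digraph.awalk (dart_graph (derived_graph G A \<alpha>)) x q y"
  shows "\<exists>p. pre_digraph.awalk (dart_graph G) (fst x) p (fst y) \<and> snd y = snd x \<otimes> net_voltage A \<alpha> p"
  using assms
proof (induction q arbitrary: x)
  case Nil
  then show ?case
    by (intro exI[of _ "[]"]) (auto simp: pre_digraph.awalk_def pre_digraph.cas.simps)
next
  case (Cons d q)
  obtain e b s where d: "d = ((e, b), s)" by (metis surj_pair)
  let ?z = "head (dart_graph (derived_graph G A \<alpha>)) d"
  interpret derived: wf_digraph "dart_graph (derived_graph G A \<alpha>)"
    by (rule wf_dart_graph[OF wf_derived_graph])
  have x: "tail (dart_graph (derived_graph G A \<alpha>)) d = x"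
    and arc: "d \<in> arcs (dart_graph (derived_graph G A \<alpha>))" and xv: "x \<in> verts (derived_graph G A \<alpha>)"
    using Cons.prems by (auto simp: pre_digraph.awalk_def pre_digraph.cas.simps)
  have "pre_digraph.awalk (dart_graph (derived_graph G A \<alpha>)) ?z q y"
    using Cons.prems derived.head_in_verts[OF arc]
    by (auto simp: pre_digraph.awalk_def pre_digraph.cas.simps)
  from Cons.IH[OF this] obtain p where p: "pre_digraph.awalk (dart_graph G) (fst ?z) p (fst y)"
    "snd y = snd ?z \<otimes> net_voltage A \<alpha> p" by blast
  have e: "e \<in> arcs G" "b \<in> carrier A" using arc d by auto
  have \<alpha>: "\<alpha> (e, s) \<in> carrier A" "\<alpha> (e, True) \<in> carrier A" "\<alpha> (e, False) = inv (\<alpha> (e, True))" for s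
    using dart_voltage[of "(e, s)"] dart_voltage[of "(e, True)"] opposite_voltage[of "(e, True)"] e
    by (simp_all add: opposite_def)
  have "pre_digraph.awalk (dart_graph G) (fst x) ((e, s) # p) (fst y)"
    using p(1) x xv e d by (cases s) (auto simp: pre_digraph.awalk_def pre_digraph.cas.simps)
  moreover have "snd ?z = snd x \<otimes> \<alpha> (e, s)"
    using x e \<alpha> d by (cases s) (auto simp: m_assoc)
  then have "snd y = snd x \<otimes> net_voltage A \<alpha> ((e, s) # p)"
    using p xv \<alpha>(1) awalk_voltage_closed[OF p(1)] by (cases x) (simp add: m_assoc)
  ultimately show ?case by blast
qed

lemma reachable_derived_iff:
  assumes "a \<in> carrier A"
  shows "(u, a) \<rightarrow>\<^sup>*\<^bsub>dart_graph (derived_graph G A \<alpha>)\<^esub> (w, b) \<longleftrightarrow>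
    (\<exists>p. pre_digraph.awalk (dart_graph G) u p w \<and> b = a \<otimes> net_voltage A \<alpha> p)"
proof -
  interpret derived: wf_digraph "dart_graph (derived_graph G A \<alpha>)"
    by (rule wf_dart_graph[OF wf_derived_graph])
  show ?thesis
    using awalk_lift[OF _ assms] awalk_project[of "(u, a)" _ "(w, b)"]
    by (auto simp: derived.reachable_awalk)
qed

text \<open>
  Reversed walks supply the inverses in the local voltage group.
\<close>

lemma awalk_reverse:
  assumes "pre_digraph.awalk (dart_graph G) u p w"
  shows "\<exists>q. pre_digraph.awalk (dart_graph G) w q u \<and> net_voltage A \<alpha> q = inv (net_voltage A \<alpha> p)"
  using assms
proof (induction p arbitrary: u)
  case Nil
  then show ?case
    by (intro exI[of _ "[]"]) (auto simp: pre_digraph.awalk_def pre_digraph.cas.simps)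
next
  case (Cons d p)
  interpret darts: wf_digraph "dart_graph G" by (rule wf_dart_graph[OF wf_digraph_axioms])
  let ?x = "head (dart_graph G) d"
  have u: "tail (dart_graph G) d = u" and d: "d \<in> arcs (dart_graph G)" and p: "darts.awalk ?x p w"
    using Cons.prems darts.head_in_verts by (auto simp: pre_digraph.awalk_def pre_digraph.cas.simps)
  obtain q where q: "darts.awalk w q ?x" "net_voltage A \<alpha> q = inv (net_voltage A \<alpha> p)"
    using Cons.IH[OF p] by blast
  have od: "opposite d \<in> arcs (dart_graph G)" using d by (cases d) (simp add: opposite_def)
  have "darts.awalk ?x [opposite d] u"
    using u od darts.head_in_verts[OF d]
    by (simp add: pre_digraph.awalk_def pre_digraph.cas.simps del: dart_graph_simps)
  with q(1) have "darts.awalk w (q @ [opposite d]) u" by (rule darts.awalk_appendI)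
  moreover have "net_voltage A \<alpha> (q @ [opposite d]) = inv (net_voltage A \<alpha> (d # p))"
    using q od d awalk_voltage_closed[OF p] dart_voltage[OF d]
    by (subst net_voltage_append)
       (auto simp: opposite_voltage inv_mult_group pre_digraph.awalk_def simp del: dart_graph_simps)
  ultimately show ?case by blast
qed

lemma subgroup_local_voltage_group:
  assumes v: "v \<in> verts G"
  shows "subgroup (local_voltage_group A \<alpha> G v) A"
proof
  interpret darts: wf_digraph "dart_graph G" by (rule wf_dart_graph[OF wf_digraph_axioms])
  show "local_voltage_group A \<alpha> G v \<subseteq> carrier A"
    using awalk_voltage_closed by (auto simp: local_voltage_group_def closed_walk_def)
  show "\<one> \<in> local_voltage_group A \<alpha> G v"
    unfolding local_voltage_group_def closed_walk_def
    by (rule CollectI, rule exI[of _ "[]"]) (simp add: v pre_digraph.awalk_def pre_digraph.cas.simps)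
  fix x assume "x \<in> local_voltage_group A \<alpha> G v"
  then obtain p where p: "darts.awalk v p v" "x = net_voltage A \<alpha> p"
    by (auto simp: local_voltage_group_def closed_walk_def)
  show "inv x \<in> local_voltage_group A \<alpha> G v"
    using awalk_reverse[OF p(1)] p(2) unfolding local_voltage_group_def closed_walk_def by force
  fix y assume "y \<in> local_voltage_group A \<alpha> G v"
  then obtain q where q: "darts.awalk v q v" "y = net_voltage A \<alpha> q"
    by (auto simp: local_voltage_group_def closed_walk_def)
  have "net_voltage A \<alpha> (p @ q) = x \<otimes> y"
    using p q by (subst net_voltage_append) (auto simp: pre_digraph.awalk_def simp del: dart_graph_simps)
  moreover have "darts.awalk v (p @ q) v" using p(1) q(1) by (rule darts.awalk_appendI)
  ultimately show "x \<otimes> y \<in> local_voltage_group A \<alpha> G v"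
    unfolding local_voltage_group_def closed_walk_def by (intro CollectI exI[of _ "p @ q"]) simp
qed

lemma closed_walk_power:
  assumes p: "closed_walk G u p"
  shows "closed_walk G u (concat (replicate n p)) \<and>
    net_voltage A \<alpha> (concat (replicate n p)) = net_voltage A \<alpha> p [^] n"
proof (induction n)
  case 0
  then show ?case
    using p by (simp add: closed_walk_def pre_digraph.awalk_def pre_digraph.cas.simps)
next
  case (Suc n)
  interpret darts: wf_digraph "dart_graph G" by (rule wf_dart_graph[OF wf_digraph_axioms])
  have walks: "darts.awalk u p u" "darts.awalk u (concat (replicate n p)) u"
    using p Suc by (auto simp: closed_walk_def)
  from darts.awalk_appendI[OF this] have "closed_walk G u (concat (replicate (Suc n) p))"
    by (simp add: closed_walk_def)
  moreover have "net_voltage A \<alpha> (p @ concat (replicate n p)) =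
      net_voltage A \<alpha> p \<otimes> net_voltage A \<alpha> (concat (replicate n p))"
    using walks by (intro net_voltage_append) (auto simp: pre_digraph.awalk_def simp del: dart_graph_simps)
  ultimately show ?case
    using Suc nat_pow_Suc2[OF awalk_voltage_closed[OF walks(1)]] by simp
qed

end

section \<open>The derived complex\<close>

locale voltage_complex = voltage_graph G A \<alpha> + glued_complex G F B
  for G :: "('v, 'e) pre_digraph" and A :: "('a, 'm) monoid_scheme" (structure)
    and \<alpha> :: "'e \<times> bool \<Rightarrow> 'a" and F :: "'f set" and B :: "('v, 'e, 'f) boundary"
begin

abbreviation boundary_voltage :: "'f \<Rightarrow> 'a" where
  "boundary_voltage f \<equiv> net_voltage A \<alpha> (snd (B f))"

lemma boundary_voltage_closed: "f \<in> F \<Longrightarrow> boundary_voltage f \<in> carrier A"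
  using boundary_closed awalk_voltage_closed unfolding closed_walk_def by blast

lemma derived_face_coset:
  assumes "(f, c) \<in> derived_faces F B A \<alpha>"
  shows "f \<in> F" "c \<subseteq> carrier A" "card c = card (generate A {boundary_voltage f})" "card c > 0"
proof -
  obtain a where a: "f \<in> F" "a \<in> carrier A" "c = a <# generate A {boundary_voltage f}"
    using assms by (auto simp: derived_faces_def)
  then have gen: "generate A {boundary_voltage f} \<subseteq> carrier A"
    using boundary_voltage_closed[OF a(1)] by (intro generate_incl) simp
  show "f \<in> F" by (fact a)
  show "c \<subseteq> carrier A" using a gen by (auto simp: l_coset_def)
  show card: "card c = card (generate A {boundary_voltage f})"
    using card_l_coset[OF a(2) gen] a(3) by simp
  show "card c > 0"
    using card card_generate_pos[OF finite_carrier boundary_voltage_closed[OF a(1)]] by simp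
qed

text \<open>
  The boundary walk of a derived face closes up because its length is chosen so: it is a lift of
  \<open>r\<close> rounds of the boundary walk below, where \<open>r\<close> is the order of the net voltage of one round.
\<close>

lemma derived_boundary_closed:
  assumes "x \<in> derived_faces F B A \<alpha>"
  shows "closed_walk (derived_graph G A \<alpha>) (fst (derived_boundary B A \<alpha> x)) (snd (derived_boundary B A \<alpha> x))"
proof -
  obtain f c where x: "x = (f, c)" by force
  note face = derived_face_coset[OF assms[unfolded x]]
  let ?b = "SOME a. a \<in> c"
  have "c \<noteq> {}" using face(4) by auto
  then have b: "?b \<in> carrier A" using face(2) some_in_eq by blast
  let ?p = "concat (replicate (card c) (snd (B f)))"
  have walk: "closed_walk G (fst (B f)) ?p" and "net_voltage A \<alpha> ?p = boundary_voltage f [^] card c"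
    using closed_walk_power[OF boundary_closed[OF face(1)]] by blast+
  then have "net_voltage A \<alpha> ?p = \<one>"
    using pow_card_generate[OF finite_carrier boundary_voltage_closed[OF face(1)]] by (simp add: face(3))
  with awalk_lift[OF walk[unfolded closed_walk_def] b] show ?thesis
    using b by (simp add: x derived_boundary_def Let_def closed_walk_def)
qed

lemma glued_complex_derived:
  "glued_complex (derived_graph G A \<alpha>) (derived_faces F B A \<alpha>) (derived_boundary B A \<alpha>)"
  by (intro glued_complex.intro wf_derived_graph glued_complex_axioms.intro derived_boundary_closed)

end

locale voltage_subcomplex = voltage_complex G A \<alpha> F B + subcomplex G F B H F'
  for G :: "('v, 'e) pre_digraph" and A :: "('a, 'm) monoid_scheme" (structure)
    and \<alpha> :: "'e \<times> bool \<Rightarrow> 'a" and F :: "'f set" and B :: "('v, 'e, 'f) boundary"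
    and H :: "('v, 'e) pre_digraph" and F' :: "'f set"
begin

lemma voltage_graph_sub: "voltage_graph H A \<alpha>"
proof (intro voltage_graph.intro voltage_graph_axioms.intro)
  show "wf_digraph H" by unfold_locales
  show "group A" by unfold_locales
  show "finite (carrier A)" by (fact finite_carrier)
  show "voltage_assignment H A \<alpha>"
    using voltage arcs_sub unfolding voltage_assignment_def by auto
qed

sublocale sub: voltage_complex H A \<alpha> F' B
  by (intro voltage_complex.intro voltage_graph_sub) unfold_locales

sublocale derived: subcomplex "derived_graph G A \<alpha>" "derived_faces F B A \<alpha>" "derived_boundary B A \<alpha>"
  "derived_graph H A \<alpha>" "derived_faces F' B A \<alpha>"
proof (intro subcomplex.intro subcomplex_axioms.intro glued_complex_derived sub.glued_complex_derived)
  show "verts (derived_graph H A \<alpha>) \<subseteq> verts (derived_graph G A \<alpha>)"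
    "arcs (derived_graph H A \<alpha>) \<subseteq> arcs (derived_graph G A \<alpha>)"
    "tail (derived_graph H A \<alpha>) = tail (derived_graph G A \<alpha>)"
    "head (derived_graph H A \<alpha>) = head (derived_graph G A \<alpha>)"
    using verts_sub arcs_sub by (auto simp: derived_graph_def tail_sub head_sub)
  show "derived_faces F' B A \<alpha> \<subseteq> derived_faces F B A \<alpha>"
    using faces_sub by (auto simp: derived_faces_def)
qed

text \<open>
  An open cell of the derived complex projects into a single open cell. For a face this is because
  \<open>z \<mapsto> z ^ r\<close> maps the open disc to itself, where \<open>r > 0\<close> as the group is finite.
\<close>

lemma lying_over_subcomplex:
  assumes "inj_on h (cell_points G F)"
  shows "lying_over G F B h A \<alpha> (h ` cell_points H F') =
    cell_points (derived_graph H A \<alpha>) (derived_faces F' B A \<alpha>)"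
proof -
  have disc: "norm (z ^ card c) < 1" if "(f, c) \<in> derived_faces F B A \<alpha>" "norm z < 1" for f c and z :: complex
    using derived_face_coset(4)[OF that(1)] that(2)
      power_strict_mono[of "norm z" 1 "card c"] by (simp add: norm_power)
  have faces: "(f, c) \<in> derived_faces F' B A \<alpha> \<longleftrightarrow> (f, c) \<in> derived_faces F B A \<alpha> \<and> f \<in> F'" for f c
    using faces_sub by (auto simp: derived_faces_def)
  have "cell_projection x \<in> cell_points G F" if "x \<in> cell_points (derived_graph G A \<alpha>) (derived_faces F B A \<alpha>)" for x
    using that disc derived_face_coset(1) by (auto simp: cell_points_def)
  then have "h (cell_projection x) \<in> h ` cell_points H F' \<longleftrightarrow> cell_projection x \<in> cell_points H F'"
    if "x \<in> cell_points (derived_graph G A \<alpha>) (derived_faces F B A \<alpha>)" for x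
    using inj_on_image_mem_iff[OF assms _ points_sub] that by blast
  moreover have "x \<in> cell_points (derived_graph G A \<alpha>) (derived_faces F B A \<alpha>) \<and> cell_projection x \<in> cell_points H F' \<longleftrightarrow>
      x \<in> cell_points (derived_graph H A \<alpha>) (derived_faces F' B A \<alpha>)" for x
    using verts_sub arcs_sub disc
    by (cases x rule: cell_projection.cases) (auto simp: cell_points_def faces)
  ultimately show ?thesis
    by (auto simp: lying_over_def derived_surface_def derived.topspace_realization)
qed

end

section \<open>Components over a subcomplex\<close>

abbreviation derived_components where
  "derived_components G F B A \<alpha> H F' \<equiv> connected_components_of
     (subtopology (derived_surface G F B A \<alpha>) (cell_points (derived_graph H A \<alpha>) (derived_faces F' B A \<alpha>)))"

text \<open>
  The base vertex \<open>v\<close> can be reached from every vertex of \<open>H\<close>, so every component over \<open>H\<close> meets the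
  fibre over \<open>v\<close>, and components can be labelled by elements of \<open>A\<close>.
\<close>

locale connected_voltage_subcomplex = voltage_subcomplex G A \<alpha> F B H F'
  for G :: "('v, 'e) pre_digraph" and A :: "('a, 'm) monoid_scheme" (structure)
    and \<alpha> :: "'e \<times> bool \<Rightarrow> 'a" and F :: "'f set" and B :: "('v, 'e, 'f) boundary"
    and H :: "('v, 'e) pre_digraph" and F' :: "'f set" +
  fixes v :: 'v
  assumes base: "v \<in> verts H" and connected: "\<And>u. u \<in> verts H \<Longrightarrow> u \<rightarrow>\<^sup>*\<^bsub>dart_graph H\<^esub> v"
begin

abbreviation voltage_group :: "'a set" where
  "voltage_group \<equiv> local_voltage_group A \<alpha> H v"

abbreviation component_at :: "'a \<Rightarrow> ('v \<times> 'a, 'e \<times> 'a, 'f \<times> 'a set) point set" where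
  "component_at a \<equiv> derived.component (Vertex (v, a))"

lemma subgroup_voltage_group: "subgroup voltage_group A"
  using base by (rule sub.subgroup_local_voltage_group)

text \<open>
  Two points of the fibre over \<open>v\<close> lie in the same component iff they are joined by a walk of the
  derived graph of \<open>H\<close>, that is by a lift of a closed walk of \<open>H\<close> at \<open>v\<close>; so components correspond to
  the left cosets of the local voltage group.
\<close>

lemma fibre_point_in_component:
  assumes "a \<in> carrier A" "b \<in> carrier A"
  shows "Vertex (v, b) \<in> component_at a \<longleftrightarrow> b \<in> a <# voltage_group"
  using derived.component_iff_reachable[of "(v, a)" "(v, b)"] assms base
  by (auto simp: sub.reachable_derived_iff l_coset_def local_voltage_group_def closed_walk_def)

lemma component_at_eq_iff:
  assumes "a \<in> carrier A" "b \<in> carrier A"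
  shows "component_at a = component_at b \<longleftrightarrow> b \<in> a <# voltage_group"
proof -
  have pt: "Vertex (v, b) \<in> cell_points (derived_graph H A \<alpha>) (derived_faces F' B A \<alpha>)"
    using base assms by (auto simp: cell_points_def)
  then have "Vertex (v, b) \<in> topspace (subtopology
      (realization (derived_graph G A \<alpha>) (derived_faces F B A \<alpha>) (derived_boundary B A \<alpha>))
      (cell_points (derived_graph H A \<alpha>) (derived_faces F' B A \<alpha>)))"
    using derived.points_sub by (auto simp: derived.topspace_realization)
  then have "component_at a = component_at b \<longleftrightarrow> Vertex (v, b) \<in> component_at a"
    by (metis connected_component_of_equiv mem_Collect_eq)
  then show ?thesis using fibre_point_in_component[OF assms] by simp
qed

lemma derived_components_eq: "derived_components G F B A \<alpha> H F' = component_at ` carrier A"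
proof (unfold derived_surface_def, rule equalityI)
  let ?T = "subtopology
    (realization (derived_graph G A \<alpha>) (derived_faces F B A \<alpha>) (derived_boundary B A \<alpha>))
    (cell_points (derived_graph H A \<alpha>) (derived_faces F' B A \<alpha>))"
  have space: "topspace ?T = cell_points (derived_graph H A \<alpha>) (derived_faces F' B A \<alpha>)"
    using derived.points_sub by (auto simp: derived.topspace_realization)
  show "connected_components_of ?T \<subseteq> component_at ` carrier A"
  proof
    fix C assume "C \<in> connected_components_of ?T"
    then obtain x where x: "x \<in> topspace ?T" "C = derived.component x"
      by (auto simp: connected_components_of_def)
    obtain y where y: "y \<in> verts (derived_graph H A \<alpha>)" "x \<in> derived.component (Vertex y)"
      using derived.component_has_vertex x(1) unfolding space by blast
    then obtain u b where ub: "y = (u, b)" "u \<in> verts H" "b \<in> carrier A" by auto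
    \<comment> \<open>Lifting a walk from \<open>u\<close> to \<open>v\<close> leads from the vertex over \<open>u\<close> to the fibre over \<open>v\<close>.\<close>
    interpret darts: wf_digraph "dart_graph H" by (rule wf_dart_graph) unfold_locales
    obtain p where p: "darts.awalk u p v"
      using connected[OF ub(2)] by (auto simp: darts.reachable_awalk)
    let ?a = "b \<otimes> net_voltage A \<alpha> p"
    have a: "?a \<in> carrier A" using ub(3) sub.awalk_voltage_closed[OF p] by simp
    have "Vertex (v, ?a) \<in> derived.component (Vertex y)"
      using derived.walk_points_in_component(2)[OF sub.awalk_lift[OF p ub(3)]] ub(1) by simp
    then have "derived.component x = component_at ?a"
      using y(2) by (metis connected_component_of_equiv mem_Collect_eq)
    then show "C \<in> component_at ` carrier A" using a x(2) by blast
  qed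
  show "component_at ` carrier A \<subseteq> connected_components_of ?T"
  proof
    fix C assume "C \<in> component_at ` carrier A"
    then obtain a where a: "a \<in> carrier A" "C = component_at a" by blast
    have "Vertex (v, a) \<in> topspace ?T" unfolding space using a base by (auto simp: cell_points_def)
    then show "C \<in> connected_components_of ?T"
      unfolding a(2) by (simp only: connected_component_in_connected_components_of)
  qed
qed

lemma card_derived_components:
  "card (derived_components G F B A \<alpha> H F') * card voltage_group = order A"
proof -
  have "\<one> <# carrier A = carrier A" by (auto simp: l_coset_def)
  then show ?thesis
    unfolding derived_components_eq order_def
    using card_image_l_coset[OF finite_carrier subgroup_self subgroup_voltage_group
        subgroup.subset[OF subgroup_voltage_group] one_closed, of component_at] component_at_eq_iff
    by simp
qed

lemma voltage_group_pos: "card voltage_group > 0"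
  using finite_subset[OF subgroup.subset[OF subgroup_voltage_group] finite_carrier]
    subgroup.one_closed[OF subgroup_voltage_group] by (auto simp: card_gt_0_iff)

text \<open>
  A set of consecutive lifts is given by the left coset of \<open>\<langle>\<omega>(W)\<rangle>\<close> over which its members start. A lift
  is connected, so it runs in \<open>C\<close> iff its starting point does, and since \<open>\<omega>(W)\<close> is a local
  voltage, the starting points of consecutive lifts all lie in one component.
\<close>

lemma card_consecutive_lift_sets_in:
  assumes W: "closed_walk H v W" and C: "C \<in> derived_components G F B A \<alpha> H F'"
  shows "card (consecutive_lift_sets_in G A \<alpha> v W C) * card (generate A {net_voltage A \<alpha> W}) =
    card voltage_group"
proof -
  let ?\<omega> = "net_voltage A \<alpha> W"
  let ?Z = "generate A {?\<omega>}"
  let ?L = "consecutive_lifts A \<alpha> v W"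
  obtain a where a: "a \<in> carrier A" "C = component_at a"
    using C unfolding derived_components_eq by blast
  have walk: "pre_digraph.awalk (dart_graph H) v W v" using W by (simp add: closed_walk_def)
  have \<omega>: "?\<omega> \<in> carrier A" "?\<omega> \<in> voltage_group"
    using sub.awalk_voltage_closed[OF walk] W by (auto simp: local_voltage_group_def)
  have Z: "subgroup ?Z A" using \<omega>(1) by (intro generate_is_subgroup) simp
  have "?Z \<subseteq> voltage_group" using \<omega>(2) by (intro generate_subgroup_incl[OF _ subgroup_voltage_group]) simp
  have lifts: "?L b = (\<lambda>x. ((v, x), lift A \<alpha> x W)) ` (b <# ?Z)" for b
  proof -
    have "b <# ?Z = (\<lambda>x. b \<otimes> x) ` ?Z" by (auto simp: l_coset_def)
    also have "\<dots> = (\<lambda>x. b \<otimes> x) ` ((\<lambda>i. ?\<omega> [^] i) ` {..<card ?Z})"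
      using generate_eq_powers[OF finite_carrier \<omega>(1)] by (rule arg_cong)
    finally show ?thesis by (simp add: consecutive_lifts_def Let_def image_image)
  qed
  have same: "?L b = ?L b' \<longleftrightarrow> b' \<in> b <# ?Z" if b: "b \<in> carrier A" "b' \<in> carrier A" for b b'
  proof -
    have inj: "inj (\<lambda>x. ((v, x), lift A \<alpha> x W))" by (auto intro: injI)
    have "?L b = ?L b' \<longleftrightarrow> b <# ?Z = b' <# ?Z"
      unfolding lifts by (rule inj_image_eq_iff[OF inj])
    also have "\<dots> \<longleftrightarrow> b' \<in> b <# ?Z"
      using l_repr_independence[OF _ b(1) Z] lcos_self[OF b(2) Z] by metis
    finally show ?thesis .
  qed
  have "(\<forall>w\<in>?L b. walk_points (derived_graph G A \<alpha>) w \<subseteq> C) \<longleftrightarrow> b \<in> a <# voltage_group"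
    if b: "b \<in> carrier A" for b
  proof
    assume runs: "\<forall>w\<in>?L b. walk_points (derived_graph G A \<alpha>) w \<subseteq> C"
    have "((v, b), lift A \<alpha> b W) \<in> ?L b" unfolding lifts using lcos_self[OF b Z] by blast
    with runs have "Vertex (v, b) \<in> C" by (auto simp: walk_points_def)
    then show "b \<in> a <# voltage_group" using fibre_point_in_component[OF a(1) b] a(2) by simp
  next
    assume ba: "b \<in> a <# voltage_group"
    show "\<forall>w\<in>?L b. walk_points (derived_graph G A \<alpha>) w \<subseteq> C"
    proof
      fix w assume "w \<in> ?L b"
      then obtain x where x: "x \<in> b <# ?Z" "w = ((v, x), lift A \<alpha> x W)" unfolding lifts by blast
      have xc: "x \<in> carrier A"
        using x(1) b subgroup.mem_carrier[OF Z] by (auto simp: l_coset_def)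
      have "x \<in> b <# voltage_group" using x(1) \<open>?Z \<subseteq> voltage_group\<close> by (auto simp: l_coset_def)
      then have "C = component_at x"
        using component_at_eq_iff[OF b xc] component_at_eq_iff[OF a(1) b] ba a(2) by simp
      then show "walk_points (derived_graph G A \<alpha>) w \<subseteq> C"
        using derived.walk_points_in_component(1)[OF sub.awalk_lift[OF walk xc]] x(2) by simp
    qed
  qed
  then have "consecutive_lift_sets_in G A \<alpha> v W C = ?L ` {b \<in> carrier A. b \<in> a <# voltage_group}"
    unfolding consecutive_lift_sets_in_def by blast
  also have "{b \<in> carrier A. b \<in> a <# voltage_group} = a <# voltage_group"
    using a(1) subgroup.subset[OF subgroup_voltage_group] by (auto simp: l_coset_def)
  finally show ?thesis
    using card_image_l_coset[OF finite_carrier subgroup_voltage_group Z \<open>?Z \<subseteq> voltage_group\<close> a(1), of ?L] same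
    by simp
qed

end

text \<open>
  A component over \<open>K\<close> is contained in a component over \<open>H\<close> as soon as they share a point, so those
  inside the component of the coset \<open>a A(v,H)\<close> are the cosets of \<open>A(v,K)\<close> that it is made of.
\<close>

lemma card_components_in_component:
  assumes "connected_voltage_subcomplex G A \<alpha> F B H F' v" "connected_voltage_subcomplex G A \<alpha> F B K F'' v"
    and sub: "verts K \<subseteq> verts H" "arcs K \<subseteq> arcs H" "F'' \<subseteq> F'"
    and C: "C \<in> derived_components G F B A \<alpha> H F'"
  shows "card {D \<in> derived_components G F B A \<alpha> K F''. D \<subseteq> C} * card (local_voltage_group A \<alpha> K v) =
    card (local_voltage_group A \<alpha> H v)"
proof -
  interpret H: connected_voltage_subcomplex G A \<alpha> F B H F' v by fact
  interpret K: connected_voltage_subcomplex G A \<alpha> F B K F'' v by fact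
  obtain a where a: "a \<in> carrier A" "C = H.component_at a"
    using C unfolding H.derived_components_eq by blast
  have groups: "local_voltage_group A \<alpha> K v \<subseteq> local_voltage_group A \<alpha> H v"
    using sub cas_dart_cong[of K H] K.tail_sub K.head_sub H.tail_sub H.head_sub
    by (auto simp: local_voltage_group_def closed_walk_def pre_digraph.awalk_def) blast
  have points: "cell_points (derived_graph K A \<alpha>) (derived_faces F'' B A \<alpha>)
      \<subseteq> cell_points (derived_graph H A \<alpha>) (derived_faces F' B A \<alpha>)"
    using sub by (auto simp: cell_points_def derived_faces_def)
  have "K.component_at b \<subseteq> C \<longleftrightarrow> b \<in> a <#\<^bsub>A\<^esub> H.voltage_group" if b: "b \<in> carrier A" for b
  proof
    assume "K.component_at b \<subseteq> C"
    moreover have "Vertex (v, b) \<in> K.component_at b"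
      using K.fibre_point_in_component[OF b b] H.lcos_self[OF b K.subgroup_voltage_group] by simp
    ultimately show "b \<in> a <#\<^bsub>A\<^esub> H.voltage_group"
      using H.fibre_point_in_component[OF a(1) b] a(2) by blast
  next
    assume "b \<in> a <#\<^bsub>A\<^esub> H.voltage_group"
    then have "C = H.component_at b" using H.component_at_eq_iff[OF a(1) b] a(2) by simp
    moreover have "K.component_at b \<subseteq> H.component_at b"
      using points unfolding connected_component_of_def connectedin_subtopology by blast
    ultimately show "K.component_at b \<subseteq> C" by simp
  qed
  then have "{D \<in> derived_components G F B A \<alpha> K F''. D \<subseteq> C} =
      K.component_at ` {b \<in> carrier A. b \<in> a <#\<^bsub>A\<^esub> H.voltage_group}"
    unfolding K.derived_components_eq by blast
  also have "{b \<in> carrier A. b \<in> a <#\<^bsub>A\<^esub> H.voltage_group} = a <#\<^bsub>A\<^esub> H.voltage_group"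
    using a(1) subgroup.subset[OF H.subgroup_voltage_group] by (auto simp: l_coset_def)
  finally show ?thesis
    using H.card_image_l_coset[OF H.finite_carrier H.subgroup_voltage_group K.subgroup_voltage_group
        groups a(1), of K.component_at] K.component_at_eq_iff by simp
qed

section \<open>The subcomplexes of a voltage graph embedding\<close>

lemma connected_imp_dart_reachable:
  assumes "wf_digraph G" "Digraph_Component.connected G" "u \<in> verts G" "w \<in> verts G"
  shows "u \<rightarrow>\<^sup>*\<^bsub>dart_graph G\<^esub> w"
proof -
  interpret darts: wf_digraph "dart_graph G" using assms(1) by (rule wf_dart_graph)
  have "u \<rightarrow>\<^sup>*\<^bsub>with_proj (mk_symmetric G)\<^esub> w"
    using assms(2-4) by (auto simp: Digraph_Component.connected_def strongly_connected_def)
  then have "(u, w) \<in> rtrancl_on (verts G) (parcs (mk_symmetric G))"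
    by (simp add: reachable_def)
  then show ?thesis
  proof (induction rule: rtrancl_on_induct)
    case base
    then show ?case by simp
  next
    case (step x y)
    then obtain e where "e \<in> arcs G" "(x, y) = (tail G e, head G e) \<or> (x, y) = (head G e, tail G e)"
      by (auto simp: parcs_mk_symmetric)
    then have "x \<rightarrow>\<^bsub>dart_graph G\<^esub> y"
      using darts.in_arcs_imp_in_arcs_ends[of "(e, True)"]
        darts.in_arcs_imp_in_arcs_ends[of "(e, False)"] by auto
    then show ?case using step.IH darts.reachable_adj_trans by blast
  qed
qed

lemma (in glued_complex) subcomplex_face_subgraph:
  assumes "Poly_Mapping.keys I \<subseteq> F"
  shows "subcomplex G F B (face_subgraph G B I) (Poly_Mapping.keys I)"
proof -
  interpret darts: wf_digraph "dart_graph G" by (rule wf_dart_graph) unfold_locales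
  let ?H = "face_subgraph G B I"
  have H: "verts ?H = (\<Union>f\<in>Poly_Mapping.keys I. set (darts.awalk_verts (fst (B f)) (snd (B f))))"
    "arcs ?H = (\<Union>f\<in>Poly_Mapping.keys I. fst ` set (snd (B f)))" "tail ?H = tail G" "head ?H = head G"
    by (simp_all add: face_subgraph_def)
  have walk: "darts.awalk (fst (B f)) (snd (B f)) (fst (B f))" if "f \<in> Poly_Mapping.keys I" for f
    using boundary_closed that assms by (auto simp: closed_walk_def)
  have ends: "tail (dart_graph G) d \<in> set (darts.awalk_verts u p) \<and> head (dart_graph G) d \<in> set (darts.awalk_verts u p)"
    if "d \<in> set p" "darts.cas u p w" for d p u w
    using that
  proof (induction p arbitrary: u)
    case (Cons d' p)
    have "head (dart_graph G) d' \<in> set (darts.awalk_verts (head (dart_graph G) d') p)"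
      using Cons.prems by (cases p) auto
    then show ?case using Cons by auto
  qed simp
  show ?thesis
  proof (intro subcomplex.intro subcomplex_axioms.intro glued_complex.intro glued_complex_axioms.intro wf_digraph.intro)
    show "tail ?H e \<in> verts ?H" "head ?H e \<in> verts ?H" if e: "e \<in> arcs ?H" for e
    proof -
      obtain f s where f: "f \<in> Poly_Mapping.keys I" "(e, s) \<in> set (snd (B f))" using e H(2) by auto
      from ends[OF f(2)] walk[OF f(1)] f(1)
      show "tail ?H e \<in> verts ?H" "head ?H e \<in> verts ?H"
        unfolding H by (cases s; auto simp: darts.awalk_def)+
    qed
    show "closed_walk ?H (fst (B f)) (snd (B f))" if f: "f \<in> Poly_Mapping.keys I" for f
    proof -
      have "fst (B f) \<in> verts ?H"
        using darts.hd_in_awalk_verts(1)[OF walk[OF f]] f by (auto simp: H)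
      moreover have "set (snd (B f)) \<subseteq> arcs (dart_graph ?H)" using f by (force simp: H)
      ultimately show ?thesis
        using walk[OF f] cas_dart_cong[OF H(3,4)] by (simp add: closed_walk_def pre_digraph.awalk_def)
    qed
    show "verts ?H \<subseteq> verts G" using darts.awalk_verts_in_verts walk by (fastforce simp: H darts.awalk_def)
    show "arcs ?H \<subseteq> arcs G" using walk by (force simp: H darts.awalk_def)
  qed (use assms H boundary_closed in \<open>auto intro: wellformed\<close>)
qed

lemma (in glued_complex) subcomplex_edge_subgraph:
  assumes "Poly_Mapping.keys y \<subseteq> arcs G"
  shows "subcomplex G F B (edge_subgraph G y) {}"
  using assms
  by (intro subcomplex.intro subcomplex_axioms.intro glued_complex.intro glued_complex_axioms.intro
      wf_digraph.intro) (auto simp: edge_subgraph_def boundary_closed)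

text \<open>
  The hypothesis on \<open>S[I]\<close> is topological; it makes the graph \<open>G[I]\<close> connected because the
  components of a subcomplex are those of its graph, applied here to the base complex.
\<close>

lemma (in glued_complex) face_subgraph_reachable:
  assumes I: "Poly_Mapping.keys I \<subseteq> F" and h: "homeomorphic_map (realization G F B) S h"
    and conn: "connectedin S (face_subcomplex G B h I)"
    and u: "u \<in> verts (face_subgraph G B I)" and w: "w \<in> verts (face_subgraph G B I)"
  shows "u \<rightarrow>\<^sup>*\<^bsub>dart_graph (face_subgraph G B I)\<^esub> w"
proof -
  interpret sub: subcomplex G F B "face_subgraph G B I" "Poly_Mapping.keys I"
    using I by (rule subcomplex_face_subgraph)
  let ?X = "cell_points (face_subgraph G B I) (Poly_Mapping.keys I)"
  have "connectedin (realization G F B) ?X"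
    using homeomorphic_map_connectedness[OF h, of ?X] conn sub.points_sub
    by (simp add: topspace_realization face_subcomplex_def)
  then have "Vertex w \<in> sub.component (Vertex u)"
    by (rule sub.in_component) (use u w in \<open>auto simp: cell_points_def\<close>)
  then show ?thesis using sub.component_iff_reachable[OF u w] by simp
qed

theorem theorem3p8:
  fixes G :: "('v, 'e) pre_digraph"
    and F :: "'f set"
    and B :: "('v, 'e, 'f) boundary"
    and S :: "'s topology"
    and h :: "('v, 'e, 'f) point \<Rightarrow> 's"
    and A :: "('a, 'm) monoid_scheme"
    and \<alpha> :: "'e \<times> bool \<Rightarrow> 'a"
    and I :: "'f \<Rightarrow>\<^sub>0 bit"
    and y :: "'e \<Rightarrow>\<^sub>0 bit"
    and v :: 'v
    and W :: "('e \<times> bool) list"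
  assumes "voltage_graph_embedding G F B S h A \<alpha>"
    and "I \<in> mod2_chains F"
    and "connectedin S (face_subcomplex G B h I)"
    and "y \<in> mod2_chains (arcs (face_subgraph G B I))"
    and "Digraph_Component.connected (edge_subgraph G y)"
    and "v \<in> verts (edge_subgraph G y)"
    and "closed_walk (edge_subgraph G y) v W"
  shows "real (card (connected_components_of (derived_surface G F B A \<alpha>))) =
           real (order A) / real (card (local_voltage_group A \<alpha> G v)) \<and>
         (\<forall>C \<in> connected_components_of (derived_surface G F B A \<alpha>).
            real (card {K \<in> components_over G F B h A \<alpha> (face_subcomplex G B h I). K \<subseteq> C}) =
              real (card (local_voltage_group A \<alpha> G v)) /
              real (card (local_voltage_group A \<alpha> (face_subgraph G B I) v))) \<and>
         (\<forall>C \<in> components_over G F B h A \<alpha> (face_subcomplex G B h I).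
            real (card {K \<in> components_over G F B h A \<alpha> (edge_subcomplex G h y). K \<subseteq> C}) =
              real (card (local_voltage_group A \<alpha> (face_subgraph G B I) v)) /
              real (card (local_voltage_group A \<alpha> (edge_subgraph G y) v))) \<and>
         (\<forall>C \<in> components_over G F B h A \<alpha> (edge_subcomplex G h y).
            real (card (consecutive_lift_sets_in G A \<alpha> v W C)) =
              real (card (local_voltage_group A \<alpha> (edge_subgraph G y) v)) /
              real (card (generate A {net_voltage A \<alpha> W})))"
proof -
  let ?GI = "face_subgraph G B I" and ?FI = "Poly_Mapping.keys I" and ?Gy = "edge_subgraph G y"
  have cellular: "cellular_embedding G F B S h" and A: "group A" "finite (carrier A)"
    and \<alpha>: "voltage_assignment G A \<alpha>"
    using assms(1) by (simp_all add: voltage_graph_embedding_def)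
  have h: "homeomorphic_map (realization G F B) S h" and "fin_digraph G"
    and connG: "Digraph_Component.connected G"
    and B: "\<And>f. f \<in> F \<Longrightarrow> closed_walk G (fst (B f)) (snd (B f))"
    using cellular by (auto simp: cellular_embedding_def finite_connected_multigraph_def)
  then have wf: "wf_digraph G" by (simp add: fin_digraph_def)
  have FI: "?FI \<subseteq> F" and y: "Poly_Mapping.keys y \<subseteq> arcs ?GI"
    using assms(2,4) by (simp_all add: mod2_chains_def)
  interpret glued_complex G F B
    using wf B by (intro glued_complex.intro glued_complex_axioms.intro)
  interpret A: group A by (rule A)
  interpret I: subcomplex G F B ?GI ?FI using FI by (rule subcomplex_face_subgraph)
  interpret y: subcomplex G F B ?Gy "{}"
    using y I.arcs_sub by (intro subcomplex_edge_subgraph) blast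
  have volt: "voltage_complex G A \<alpha> F B"
    using A \<alpha> by (intro voltage_complex.intro voltage_graph.intro voltage_graph_axioms.intro) unfold_locales
  have Gy: "verts ?Gy \<subseteq> verts ?GI" "arcs ?Gy \<subseteq> arcs ?GI"
    using y I.sub.wellformed by (auto simp: edge_subgraph_def I.tail_sub I.head_sub)
  have v: "v \<in> verts ?GI" "v \<in> verts G" using assms(6) Gy(1) I.verts_sub by auto
  \<comment> \<open>The surface itself counts as the subcomplex of all cells, so that all three levels are alike.\<close>
  have subG: "subcomplex G F B G F"
    by (intro subcomplex.intro subcomplex_axioms.intro glued_complex_axioms) auto
  have cG: "connected_voltage_subcomplex G A \<alpha> F B G F v"
    using v connected_imp_dart_reachable[OF wf connG]
    by (intro connected_voltage_subcomplex.intro connected_voltage_subcomplex_axioms.intro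
        voltage_subcomplex.intro volt subG) auto
  have cI: "connected_voltage_subcomplex G A \<alpha> F B ?GI ?FI v"
    using v face_subgraph_reachable[OF FI h assms(3)]
    by (intro connected_voltage_subcomplex.intro connected_voltage_subcomplex_axioms.intro
        voltage_subcomplex.intro volt I.subcomplex_axioms) auto
  have cy: "connected_voltage_subcomplex G A \<alpha> F B ?Gy {} v"
    using assms(6) connected_imp_dart_reachable[OF y.sub.wf_digraph_axioms assms(5)]
    by (intro connected_voltage_subcomplex.intro connected_voltage_subcomplex_axioms.intro
        voltage_subcomplex.intro volt y.subcomplex_axioms) auto
  interpret cG: connected_voltage_subcomplex G A \<alpha> F B G F v by (rule cG)
  interpret cI: connected_voltage_subcomplex G A \<alpha> F B ?GI ?FI v by (rule cI)
  interpret cy: connected_voltage_subcomplex G A \<alpha> F B ?Gy "{}" v by (rule cy)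
  have inj: "inj_on h (cell_points G F)"
    using homeomorphic_imp_injective_map[OF h] by (simp add: topspace_realization)
  have compG: "connected_components_of (derived_surface G F B A \<alpha>) = derived_components G F B A \<alpha> G F"
    by (metis cG.derived.topspace_realization derived_surface_def subtopology_topspace)
  have compI: "components_over G F B h A \<alpha> (face_subcomplex G B h I) = derived_components G F B A \<alpha> ?GI ?FI"
    unfolding components_over_def face_subcomplex_def cI.lying_over_subcomplex[OF inj] ..
  have compy: "components_over G F B h A \<alpha> (edge_subcomplex G h y) = derived_components G F B A \<alpha> ?Gy {}"
    unfolding components_over_def edge_subcomplex_def cy.lying_over_subcomplex[OF inj] ..
  have quotient: "real m = real n / real k" if "m * k = n" "k > 0" for m n k :: nat
    using that by (auto simp: field_simps)
  have "net_voltage A \<alpha> W \<in> carrier A"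
    using assms(7) cy.sub.awalk_voltage_closed unfolding closed_walk_def by blast
  note pos = cG.voltage_group_pos cI.voltage_group_pos cy.voltage_group_pos
    A.card_generate_pos[OF A(2) this]
  show ?thesis
    unfolding compG compI compy
  proof (intro conjI ballI quotient pos)
    show "card (derived_components G F B A \<alpha> G F) * card (local_voltage_group A \<alpha> G v) = order A"
      by (rule cG.card_derived_components)
  qed (use card_components_in_component[OF cG cI I.verts_sub I.arcs_sub FI]
      card_components_in_component[OF cI cy Gy empty_subsetI]
      cy.card_consecutive_lift_sets_in[OF assms(7)] in simp_all)
qed

end
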